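(* Assume the Undirected $k$-pairs Conjecture (stated in the context) holds. Then any randomized external memory algorithm for the matrix transpose problem on $n\times n$ matrices with $w$-bit integer entries, with error probability at most $1/3$, must make an expected $$\Omega\left(\min\left\{\frac{n^2\lg_{2M/B}B}{B},\ \frac{n^2w}{\lg(n^2w)}\right\}\right)$$ I/Os.
   Context: External memory model: internal memory of $M$ words of $w$ bits ($m=Mw$ bits), unbounded disk partitioned into blocks of $B$ consecutive $w$-bit words ($b=Bw$ bits). An I/O reads or writes one disk block; computation in memory is free and unrestricted. Cost is the number of I/Os. Matrix transpose problem: the input $n\times n$ matrix $A$ with $w$-bit entries is stored in row-major order, i.e. each row occupies $n/B$ consecutive blocks of $B$ entries each; the algorithm must output $A^T$ in the same format, i.e. $n/B$ blocks per column of $A$, each containing a consecutive range of $B$ entries of that column in order. Undirected $k$-pairs Conjecture (Li and Li). An instance is a directed acyclic graph $G=(V,E)$ with capacities $c(e)>0$ and $k$ source–sink pairs $(s_i,t_i)$, each with demand $1$. Each source $s_i$ receives a message $A_i$ drawn uniformly and independently from a finite set. A network coding solution assigns to every edge $e=(u,v)$ an alphabet and a function giving the message on $e$ from the messages on the in-edges of $u$, and to every sink $t_i$ a decoding function of the messages on its in-edges, which must output $A_i$ for all inputs. It achieves rate $r$ if $H(A_i)\ge r$ for all $i$ and $H(A_e)\le c(e)$ for every edge $e$, where $A_e$ is the random message on $e$ and $H$ is binary Shannon entropy. A multicommodity flow in the undirected version $G'$ of $G$ consists of fractional flows $f_i$ supported on edges, satisfying flow conservation and sending one unit from $s_i$ to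 $t_i$; it achieves rate $r$ if $r\sum_i (f_i(u,v)+f_i(v,u))\le c(e)$ for every edge $e=\{u,v\}$. The conjecture states: for every such instance, the achievable network coding rate in $G$ is at most the achievable multicommodity flow rate in $G'$. *)

theory Defs
  imports "HOL-Probability.Probability" "Jordan_Normal_Form.Matrix"
begin

section \<open>Network coding and the undirected $k$-pairs conjecture\<close>

record 'v k_pairs =
  verts :: "'v set"
  edges :: "('v \<times> 'v) set"
  cap :: "'v \<times> 'v \<Rightarrow> real"
  npairs :: nat
  source :: "nat \<Rightarrow> 'v"
  sink :: "nat \<Rightarrow> 'v"

definition k_pairs_instance :: "'v k_pairs \<Rightarrow> bool" where
  "k_pairs_instance G \<longleftrightarrow>
     finite (verts G) \<and> edges G \<subseteq> verts G \<times> verts G \<and> acyclic (edges G) \<and>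
     (\<forall>e\<in>edges G. cap G e > 0) \<and>
     (\<forall>i<npairs G. source G i \<in> verts G \<and> sink G i \<in> verts G \<and> source G i \<noteq> sink G i)"

definition in_edges :: "'v k_pairs \<Rightarrow> 'v \<Rightarrow> ('v \<times> 'v) set" where
  "in_edges G u = {e \<in> edges G. snd e = u}"

definition sources_at :: "'v k_pairs \<Rightarrow> 'v \<Rightarrow> nat set" where
  "sources_at G u = {i. i < npairs G \<and> source G i = u}"

text \<open>
  Messages and edge symbols are encoded as natural numbers. What is received at a node \<open>u\<close>
  consists of the symbols on the edges into \<open>u\<close> and of the source messages injected at \<open>u\<close>
  (the usual convention that every source message arrives on an extra in-edge of its source).
  The functions attached to edges and sinks get exactly these two families as arguments.
\<close>

record 'v coding_solution =
  messages :: "nat \<Rightarrow> nat set"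
  alphabet :: "'v \<times> 'v \<Rightarrow> nat set"
  edge_fun :: "'v \<times> 'v \<Rightarrow> ('v \<times> 'v \<Rightarrow> nat) \<Rightarrow> (nat \<Rightarrow> nat) \<Rightarrow> nat"
  decoder :: "nat \<Rightarrow> ('v \<times> 'v \<Rightarrow> nat) \<Rightarrow> (nat \<Rightarrow> nat) \<Rightarrow> nat"

definition inputs :: "'v k_pairs \<Rightarrow> 'v coding_solution \<Rightarrow> (nat \<Rightarrow> nat) set" where
  "inputs G S = PiE {..<npairs G} (messages S)"

definition received_funs ::
  "'v k_pairs \<Rightarrow> 'v coding_solution \<Rightarrow> 'v \<Rightarrow> nat set \<Rightarrow> (('v \<times> 'v \<Rightarrow> nat) \<Rightarrow> (nat \<Rightarrow> nat) \<Rightarrow> nat) set" where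
  "received_funs G S u Y =
     (PiE (in_edges G u) (alphabet S) \<rightarrow> (PiE (sources_at G u) (messages S) \<rightarrow> Y))"

definition well_typed_solution :: "'v k_pairs \<Rightarrow> 'v coding_solution \<Rightarrow> bool" where
  "well_typed_solution G S \<longleftrightarrow>
     (\<forall>i<npairs G. finite (messages S i) \<and> messages S i \<noteq> {}) \<and>
     (\<forall>e\<in>edges G. edge_fun S e \<in> received_funs G S (fst e) (alphabet S e)) \<and>
     (\<forall>i<npairs G. decoder S i \<in> received_funs G S (sink G i) (messages S i))"

definition transmission ::
  "'v k_pairs \<Rightarrow> 'v coding_solution \<Rightarrow> (nat \<Rightarrow> nat) \<Rightarrow> ('v \<times> 'v \<Rightarrow> nat) \<Rightarrow> bool" where
  "transmission G S a x \<longleftrightarrow>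
     x \<in> extensional (edges G) \<and>
     (\<forall>e\<in>edges G. x e =
        edge_fun S e (restrict x (in_edges G (fst e))) (restrict a (sources_at G (fst e))))"

text \<open>The symbols sent over the edges on input \<open>a\<close>; they are well defined because the graph is
  acyclic, see \<open>ex1_transmission\<close>.\<close>

definition sent :: "'v k_pairs \<Rightarrow> 'v coding_solution \<Rightarrow> (nat \<Rightarrow> nat) \<Rightarrow> 'v \<times> 'v \<Rightarrow> nat" where
  "sent G S a = (THE x. transmission G S a x)"

lemma ex1_transmission:
  assumes "k_pairs_instance G"
  shows "\<exists>!x. transmission G S a x"
proof -
  define F where "F = (\<lambda>x e. if e \<in> edges G then
        edge_fun S e (restrict x (in_edges G (fst e))) (restrict a (sources_at G (fst e)))
      else undefined)"
  define R where "R = {(e', e). e' \<in> edges G \<and> e \<in> edges G \<and> snd e' = fst e}"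
  have "finite (verts G \<times> verts G)" "edges G \<subseteq> verts G \<times> verts G" "acyclic (edges G)"
    using assms by (simp_all add: k_pairs_instance_def)
  then have "wf (edges G)"
    by (meson finite_acyclic_wf finite_subset)
  then have "wf (inv_image (edges G) fst)" by (rule wf_inv_image)
  then have wf: "wf R"
    by (rule wf_subset) (auto simp: inv_image_def R_def)
  have F_cong: "F x e = F y e" if "\<And>e'. (e', e) \<in> R \<Longrightarrow> x e' = y e'" for x y e
  proof (cases "e \<in> edges G")
    case True
    then have "restrict x (in_edges G (fst e)) = restrict y (in_edges G (fst e))"
      using that by (intro restrict_ext) (simp add: R_def in_edges_def)
    then show ?thesis by (simp add: F_def)
  qed (simp add: F_def)
  then have "adm_wf R F"
    unfolding adm_wf_def by blast
  note fixpoint = fun_cong[OF wfrec_fixpoint[OF wf this]]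
  have eq: "transmission G S a x \<longleftrightarrow> (\<forall>e. x e = F x e)" for x
    unfolding transmission_def extensional_def F_def by auto
  show ?thesis
  proof (rule ex1I)
    show "transmission G S a (wfrec R F)"
      unfolding eq by (intro allI fixpoint)
  next
    fix x assume "transmission G S a x"
    then have x: "x e = F x e" for e unfolding eq by blast
    show "x = wfrec R F"
    proof
      fix e show "x e = wfrec R F e"
      proof (induction e rule: wf_induct_rule[OF wf])
        case (1 e)
        have "x e = F x e" by (rule x)
        also have "\<dots> = F (wfrec R F) e" by (rule F_cong) (rule 1)
        also have "\<dots> = wfrec R F e" by (rule fixpoint[symmetric])
        finally show ?case .
      qed
    qed
  qed
qed

definition decodes :: "'v k_pairs \<Rightarrow> 'v coding_solution \<Rightarrow> bool" where
  "decodes G S \<longleftrightarrow> (\<forall>a\<in>inputs G S. \<forall>i<npairs G.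
     decoder S i (restrict (sent G S a) (in_edges G (sink G i)))
       (restrict a (sources_at G (sink G i))) = a i)"

text \<open>Binary Shannon entropy of a function of the source messages, which are independent and
  uniform, i.e. uniform on the product set \<open>inputs G S\<close>.\<close>

definition msg_entropy ::
  "'v k_pairs \<Rightarrow> 'v coding_solution \<Rightarrow> ((nat \<Rightarrow> nat) \<Rightarrow> nat) \<Rightarrow> real" where
  "msg_entropy G S X = prob_space.entropy (uniform_count_measure (inputs G S)) 2
     (count_space (X ` inputs G S)) X"

definition coding_achieves :: "'v k_pairs \<Rightarrow> real \<Rightarrow> bool" where
  "coding_achieves G r \<longleftrightarrow> (\<exists>S. well_typed_solution G S \<and> decodes G S \<and>
     (\<forall>i<npairs G. msg_entropy G S (\<lambda>a. a i) \<ge> r) \<and>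
     (\<forall>e\<in>edges G. msg_entropy G S (\<lambda>a. sent G S a e) \<le> cap G e))"

text \<open>Flows live in the undirected graph underlying \<open>G\<close>: \<open>f i (u, v)\<close> is the flow of commodity
  \<open>i\<close> from \<open>u\<close> to \<open>v\<close>, which may be positive if \<open>(u, v)\<close> or \<open>(v, u)\<close> is an edge of \<open>G\<close>.\<close>

definition unit_flows :: "'v k_pairs \<Rightarrow> (nat \<Rightarrow> 'v \<times> 'v \<Rightarrow> real) \<Rightarrow> bool" where
  "unit_flows G f \<longleftrightarrow> (\<forall>i<npairs G.
     (\<forall>u v. f i (u, v) \<ge> 0) \<and>
     (\<forall>u v. (u, v) \<notin> edges G \<longrightarrow> (v, u) \<notin> edges G \<longrightarrow> f i (u, v) = 0) \<and>
     (\<forall>u\<in>verts G - {source G i, sink G i}.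
        (\<Sum>v\<in>verts G. f i (v, u)) = (\<Sum>v\<in>verts G. f i (u, v))) \<and>
     (\<Sum>v\<in>verts G. f i (source G i, v)) - (\<Sum>v\<in>verts G. f i (v, source G i)) = 1 \<and>
     (\<Sum>v\<in>verts G. f i (v, sink G i)) - (\<Sum>v\<in>verts G. f i (sink G i, v)) = 1)"

definition flow_achieves :: "'v k_pairs \<Rightarrow> real \<Rightarrow> bool" where
  "flow_achieves G r \<longleftrightarrow> (\<exists>f. unit_flows G f \<and>
     (\<forall>(u, v)\<in>edges G. r * (\<Sum>i<npairs G. f i (u, v) + f i (v, u)) \<le> cap G (u, v)))"

text \<open>Rates are suprema in \<^typ>\<open>ennreal\<close>, so that the flow rate is \<open>0\<close>, and not undefined, if some
  pair is disconnected and no unit flow exists.\<close>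

definition coding_rate :: "'v k_pairs \<Rightarrow> ennreal" where
  "coding_rate G = (SUP r\<in>{r. coding_achieves G r}. ennreal r)"

definition flow_rate :: "'v k_pairs \<Rightarrow> ennreal" where
  "flow_rate G = (SUP r\<in>{r. flow_achieves G r}. ennreal r)"

text \<open>Instances are finite, so vertices may be taken to be natural numbers.\<close>

definition undirected_k_pairs_conjecture :: bool where
  "undirected_k_pairs_conjecture \<longleftrightarrow>
     (\<forall>G :: nat k_pairs. k_pairs_instance G \<longrightarrow> coding_rate G \<le> flow_rate G)"


section \<open>External memory algorithms\<close>

text \<open>Words are natural numbers below \<open>2 ^ w\<close>. The memory is a list of \<open>M\<close> words, and the disk maps
  every block address to a list of \<open>B\<close> words.\<close>

definition word_lists :: "nat \<Rightarrow> nat \<Rightarrow> nat list set" where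
  "word_lists w k = {xs. length xs = k \<and> set xs \<subseteq> {..<2 ^ w}}"

type_synonym memory = "nat list"
type_synonym disk = "nat \<Rightarrow> nat list"

text \<open>\<open>Read d p\<close> copies the block with address \<open>d\<close> to the memory positions \<open>p, \<dots>, p + B - 1\<close>, and
  \<open>Write d p\<close> copies these positions to the block.\<close>

datatype action = Halt | Read nat nat | Write nat nat

text \<open>
  A deterministic algorithm may, before its \<open>t\<close>-th action, replace the memory contents by an
  arbitrary function of them, and it picks the action by looking at the memory only. Both may
  depend on \<open>t\<close>: an algorithm drawn from a distribution can thereby use fresh random bits in every
  step.
\<close>

type_synonym algorithm = "nat \<Rightarrow> memory \<Rightarrow> memory \<times> action"

definition valid_algorithm :: "nat \<Rightarrow> nat \<Rightarrow> nat \<Rightarrow> algorithm \<Rightarrow> bool" where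
  "valid_algorithm M B w alg \<longleftrightarrow> (\<forall>t. \<forall>s\<in>word_lists w M.
     fst (alg t s) \<in> word_lists w M \<and>
     (case snd (alg t s) of
        Halt \<Rightarrow> True
      | Read d p \<Rightarrow> p + B \<le> M
      | Write d p \<Rightarrow> p + B \<le> M))"

fun perform :: "nat \<Rightarrow> memory \<times> action \<Rightarrow> disk \<Rightarrow> memory \<times> disk" where
  "perform B (s, Halt) D = (s, D)"
| "perform B (s, Read d p) D = (take p s @ D d @ drop (p + B) s, D)"
| "perform B (s, Write d p) D = (s, D(d := take B (drop p s)))"

primrec run :: "nat \<Rightarrow> nat \<Rightarrow> algorithm \<Rightarrow> disk \<Rightarrow> nat \<Rightarrow> memory \<times> disk" where
  "run M B alg D 0 = (replicate M 0, D)"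
| "run M B alg D (Suc t) = (case run M B alg D t of (s, D') \<Rightarrow> perform B (alg t s) D')"

definition halts_at :: "nat \<Rightarrow> nat \<Rightarrow> algorithm \<Rightarrow> disk \<Rightarrow> nat \<Rightarrow> bool" where
  "halts_at M B alg D t \<longleftrightarrow> snd (alg t (fst (run M B alg D t))) = Halt"

text \<open>Every action before the first \<^const>\<open>Halt\<close> is an I/O; the count is \<open>\<infinity>\<close> without a \<^const>\<open>Halt\<close>.\<close>

definition num_ios :: "nat \<Rightarrow> nat \<Rightarrow> algorithm \<Rightarrow> disk \<Rightarrow> enat" where
  "num_ios M B alg D = (INF t\<in>{t. halts_at M B alg D t}. enat t)"


section \<open>The matrix transpose problem\<close>

definition word_matrices :: "nat \<Rightarrow> nat \<Rightarrow> nat mat set" where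
  "word_matrices n w = {A \<in> carrier_mat n n. \<forall>i<n. \<forall>j<n. A $$ (i, j) < 2 ^ w}"

definition row_block :: "nat \<Rightarrow> nat mat \<Rightarrow> nat \<Rightarrow> nat \<Rightarrow> nat list" where
  "row_block B A i j = map (\<lambda>l. A $$ (i, j * B + l)) [0..<B]"

definition stored_at :: "nat \<Rightarrow> nat \<Rightarrow> disk \<Rightarrow> nat \<Rightarrow> nat mat \<Rightarrow> bool" where
  "stored_at n B D d A \<longleftrightarrow>
     (\<forall>i<n. \<forall>j<n div B. D (d + i * (n div B) + j) = row_block B A i j)"

definition input_disk :: "nat \<Rightarrow> nat \<Rightarrow> nat mat \<Rightarrow> disk" where
  "input_disk n B A d =
     (if d < n * (n div B) then row_block B A (d div (n div B)) (d mod (n div B))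
      else replicate B 0)"

lemma stored_at_input_disk:
  shows "stored_at n B (input_disk n B A) 0 A"
proof -
  have "i * (n div B) + j < n * (n div B)" if "i < n" "j < n div B" for i j
    using that mult_le_mono1[of "Suc i" n "n div B"] by simp
  then show ?thesis by (auto simp: stored_at_def input_disk_def)
qed

text \<open>The output has to be on the disk, starting at the prescribed block \<open>out\<close>, when the algorithm
  halts; \<open>out = 0\<close> means transposing in place.\<close>

definition transposes ::
  "nat \<Rightarrow> nat \<Rightarrow> nat \<Rightarrow> nat \<Rightarrow> algorithm \<Rightarrow> nat mat \<Rightarrow> bool" where
  "transposes n M B out alg A \<longleftrightarrow> (\<exists>t. num_ios M B alg (input_disk n B A) = enat t \<and>
     stored_at n B (snd (run M B alg (input_disk n B A) t)) out (transpose_mat A))"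

text \<open>A randomized algorithm is a probability distribution over deterministic algorithms.\<close>

definition randomized_transpose_algorithm ::
  "nat \<Rightarrow> nat \<Rightarrow> nat \<Rightarrow> nat \<Rightarrow> nat \<Rightarrow> real \<Rightarrow> algorithm measure \<Rightarrow> bool" where
  "randomized_transpose_algorithm n M B w out \<delta> R \<longleftrightarrow>
     prob_space R \<and>
     (\<forall>alg\<in>space R. valid_algorithm M B w alg) \<and>
     (\<forall>A\<in>word_matrices n w.
        (\<lambda>alg. num_ios M B alg (input_disk n B A)) \<in> R \<rightarrow>\<^sub>M count_space UNIV \<and>
        {alg \<in> space R. transposes n M B out alg A} \<in> sets R \<and>
        measure R {alg \<in> space R. \<not> transposes n M B out alg A} \<le> \<delta>)"

definition expected_ios :: "nat \<Rightarrow> nat \<Rightarrow> nat \<Rightarrow> algorithm measure \<Rightarrow> nat mat \<Rightarrow> ennreal" where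
  "expected_ios n M B R A = (\<integral>\<^sup>+ alg. ennreal_of_enat (num_ios M B alg (input_disk n B A)) \<partial>R)"

end

theory Submission
  imports Defs "HOL-Real_Asymp.Real_Asymp"
begin

text \<open>
  By averaging, some deterministic algorithm is correct and makes at most \<open>T\<close> I/Os on at least half
  of all matrices. A run is described by \<open>T\<close> choices from a polynomially large set, namely which
  version of which block each step accesses. So if \<open>T\<close> is below the second term of the minimum, a set
  \<open>\<Gamma>\<close> of at least \<open>2 ^ ((1 - \<epsilon>) m)\<close> of the \<open>2 ^ m\<close> matrices, where \<open>m = n ^ 2 * w\<close>, shares one
  description, and on \<open>\<Gamma>\<close> the algorithm is a fixed network.

  Independent uniform messages need not lie in \<open>\<Gamma>\<close>. By concentration of measure in the cube, however,
  the average Hamming distance to \<open>\<Gamma>\<close> is at most \<open>m / 128\<close>. A hub that sees all messages tells the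
  input and output blocks which bits to flip, so that the algorithm runs on a nearest member of \<open>\<Gamma>\<close>;
  these corrections have small entropy.

  The conjecture turns this coding solution into a flow, which is bounded by linear programming
  duality. Give length 1 to block transfers and to the edges between phases of \<open>M / B\<close> steps, and length
  \<open>L / 2\<close> to the edges at the hub. A phase has \<open>O(M / B)\<close> neighbours, so most pairs have distance at
  least \<open>L\<close> for some \<open>L\<close> of the order of \<open>log B\<close> to base \<open>2M / B\<close>. The edges into the hub have total
  capacity \<open>m\<close>, but a route through the hub uses two hub edges, so they account for only half of the
  total demand \<open>m L\<close>; the rest is paid by the algorithm's own edges, whose capacities times lengths
  add up to \<open>O(T B w)\<close>.
\<close>

subsection \<open>Potentials bound multicommodity flows\<close>

text \<open>Summation by parts: collecting the terms of each vertex leaves its net inflow times its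
  potential, and conservation cancels every vertex except source and sink.\<close>

lemma unit_flow_potential:
  fixes \<phi> :: "'v \<Rightarrow> real"
  assumes inst: "k_pairs_instance G" and flow: "unit_flows G f" and i: "i < npairs G"
  shows "(\<Sum>u\<in>verts G. \<Sum>v\<in>verts G. f i (u, v) * (\<phi> v - \<phi> u)) = \<phi> (sink G i) - \<phi> (source G i)"
proof -
  let ?V = "verts G" and ?s = "source G i" and ?t = "sink G i"
  define ex where "ex v = (\<Sum>u\<in>?V. f i (u, v)) - (\<Sum>u\<in>?V. f i (v, u))" for v
  have fin: "finite ?V" and st: "?s \<in> ?V" "?t \<in> ?V" "?s \<noteq> ?t"
    using inst i by (auto simp: k_pairs_instance_def)
  have ex: "ex ?s = -1" "ex ?t = 1" "\<And>v. v \<in> ?V - {?s, ?t} \<Longrightarrow> ex v = 0"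
    using flow i unfolding unit_flows_def ex_def by (auto simp: algebra_simps)
  have "(\<Sum>u\<in>?V. \<Sum>v\<in>?V. f i (u, v) * (\<phi> v - \<phi> u))
      = (\<Sum>u\<in>?V. \<Sum>v\<in>?V. f i (u, v) * \<phi> v) - (\<Sum>u\<in>?V. \<Sum>v\<in>?V. f i (u, v) * \<phi> u)"
    by (simp add: right_diff_distrib sum_subtractf)
  also have "(\<Sum>u\<in>?V. \<Sum>v\<in>?V. f i (u, v) * \<phi> v) = (\<Sum>v\<in>?V. (\<Sum>u\<in>?V. f i (u, v)) * \<phi> v)"
    by (subst sum.swap) (simp add: sum_distrib_right)
  also have "\<dots> - (\<Sum>u\<in>?V. \<Sum>v\<in>?V. f i (u, v) * \<phi> u) = (\<Sum>v\<in>?V. ex v * \<phi> v)"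
    by (simp add: ex_def left_diff_distrib sum_subtractf sum_distrib_right)
  also have "\<dots> = (\<Sum>v\<in>{?s, ?t}. ex v * \<phi> v)"
    using fin st ex by (intro sum.mono_neutral_right) auto
  also have "\<dots> = \<phi> ?t - \<phi> ?s"
    using st ex by simp
  finally show ?thesis .
qed

text \<open>Weak linear programming duality. Each commodity has its own potential, but all are
  Lipschitz for common edge lengths, so the potential differences must be paid out of the
  length-weighted capacity.\<close>

lemma flow_achieves_potential_bound:
  fixes \<phi> :: "nat \<Rightarrow> 'v \<Rightarrow> real"
  assumes inst: "k_pairs_instance G" and ach: "flow_achieves G r" and r: "r \<ge> 0" and pos: "npairs G > 0"
    and len: "\<And>i u v. i < npairs G \<Longrightarrow> (u, v) \<in> edges G \<Longrightarrow> \<bar>\<phi> i v - \<phi> i u\<bar> \<le> len (u, v)"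
  shows "r * (\<Sum>i<npairs G. \<phi> i (sink G i) - \<phi> i (source G i)) \<le> (\<Sum>e\<in>edges G. len e * cap G e)"
proof -
  let ?V = "verts G" and ?E = "edges G"
  from ach obtain f where flow: "unit_flows G f"
    and cap: "\<forall>(u, v)\<in>?E. r * (\<Sum>i<npairs G. f i (u, v) + f i (v, u)) \<le> cap G (u, v)"
    unfolding flow_achieves_def by blast
  have fin: "finite ?V" and EV: "?E \<subseteq> ?V \<times> ?V"
    using inst by (auto simp: k_pairs_instance_def)
  then have finE: "finite ?E" by (meson finite_SigmaI finite_subset)
  have bound: "\<phi> i (sink G i) - \<phi> i (source G i) \<le> (\<Sum>e\<in>?E. len e * (f i e + f i (prod.swap e)))"
    if i: "i < npairs G" for i
  proof -
    have nn: "f i e \<ge> 0" for e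
      using flow i by (cases e) (simp add: unit_flows_def)
    have z: "f i (u, v) = 0" if "(u, v) \<notin> ?E" "(v, u) \<notin> ?E" for u v
      using flow i that by (simp add: unit_flows_def)
    define g where "g e = f i e * \<bar>\<phi> i (snd e) - \<phi> i (fst e)\<bar>" for e
    have g0: "g e \<ge> 0" for e using nn by (simp add: g_def)
    have "\<phi> i (sink G i) - \<phi> i (source G i) = (\<Sum>e\<in>?V \<times> ?V. f i e * (\<phi> i (snd e) - \<phi> i (fst e)))"
      using unit_flow_potential[OF inst flow i, of "\<phi> i"]
      by (simp add: sum.cartesian_product case_prod_beta)
    also have "\<dots> \<le> (\<Sum>e\<in>?V \<times> ?V. g e)"
      unfolding g_def by (intro sum_mono mult_left_mono nn) auto
    \<comment> \<open>Flow may run along an edge in either direction and vanishes on all other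
      pairs.\<close>
    also have "\<dots> = (\<Sum>e\<in>?E \<union> prod.swap ` ?E. g e)"
      using fin EV z by (intro sum.mono_neutral_right) (force simp: g_def image_iff)+
    also have "\<dots> \<le> (\<Sum>e\<in>?E. g e) + (\<Sum>e\<in>prod.swap ` ?E. g e)"
      using sum.union_inter[of ?E "prod.swap ` ?E" g] finE
        sum_nonneg[of "?E \<inter> prod.swap ` ?E" g] g0 by auto
    also have "(\<Sum>e\<in>prod.swap ` ?E. g e) = (\<Sum>e\<in>?E. g (prod.swap e))"
      by (subst sum.reindex) (auto simp: inj_on_def)
    also have "(\<Sum>e\<in>?E. g e) + (\<Sum>e\<in>?E. g (prod.swap e))
        = (\<Sum>e\<in>?E. \<bar>\<phi> i (snd e) - \<phi> i (fst e)\<bar> * (f i e + f i (prod.swap e)))"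
      by (simp add: g_def sum.distrib[symmetric] algebra_simps abs_minus_commute)
    also have "\<dots> \<le> (\<Sum>e\<in>?E. len e * (f i e + f i (prod.swap e)))"
      using len[OF i] by (intro sum_mono mult_right_mono add_nonneg_nonneg nn) (auto split: prod.splits)
    finally show ?thesis .
  qed
  have len0: "len e \<ge> 0" if "e \<in> ?E" "npairs G > 0" for e
    using len[OF that(2), of "fst e" "snd e"] that(1) by (auto intro: order_trans[OF abs_ge_zero])
  have "r * (\<Sum>i<npairs G. \<phi> i (sink G i) - \<phi> i (source G i))
      \<le> r * (\<Sum>i<npairs G. \<Sum>e\<in>?E. len e * (f i e + f i (prod.swap e)))"
    using bound r by (intro mult_left_mono sum_mono) auto
  also have "\<dots> = (\<Sum>e\<in>?E. len e * (r * (\<Sum>i<npairs G. f i e + f i (prod.swap e))))"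
    by (subst sum.swap) (simp add: sum_distrib_left mult_ac)
  also have "\<dots> \<le> (\<Sum>e\<in>?E. len e * cap G e)"
    using cap len0 pos by (intro sum_mono mult_left_mono) (auto split: prod.splits)
  finally show ?thesis .
qed

subsection \<open>Entropy of coded messages\<close>

lemma msg_entropy_eq:
  fixes G :: "'v k_pairs" and S :: "'v coding_solution" and X :: "(nat \<Rightarrow> nat) \<Rightarrow> nat"
  assumes fin: "finite (inputs G S)" and ne: "inputs G S \<noteq> {}"
  defines "P y \<equiv> card (X -` {y} \<inter> inputs G S) / card (inputs G S)"
  shows "msg_entropy G S X = - (\<Sum>y\<in>X ` inputs G S. P y * log 2 (P y))"
proof -
  interpret prob_space "uniform_count_measure (inputs G S)"
    by (rule prob_space_uniform_count_measure[OF fin ne])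
  interpret information_space "uniform_count_measure (inputs G S)" 2
    by standard simp
  have *: "space (uniform_count_measure (inputs G S)) = inputs G S"
    by (simp add: space_uniform_count_measure)
  have "simple_distributed (uniform_count_measure (inputs G S)) X P"
  proof (rule simple_distributedI)
    show "simple_function (uniform_count_measure (inputs G S)) X"
      using fin by (simp add: simple_function_def * sets_uniform_count_measure)
    show "P y \<ge> 0" for y by (simp add: P_def)
    show "P x = prob (X -` {x} \<inter> space (uniform_count_measure (inputs G S)))" for x
      unfolding * using fin by (subst measure_uniform_count_measure) (auto simp: P_def)
  qed
  from entropy_simple_distributed[OF this] show ?thesis
    by (simp add: msg_entropy_def *)
qed

text \<open>Gibbs' inequality, with \<open>g y\<close> the length of the code word for \<open>y\<close> in a code that satisfies
  Kraft's inequality.\<close>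

lemma msg_entropy_le_mean_cost:
  fixes g :: "nat \<Rightarrow> real"
  assumes fin: "finite (inputs G S)" and ne: "inputs G S \<noteq> {}"
    and kraft: "(\<Sum>y\<in>X ` inputs G S. 2 powr (- g y)) \<le> 1"
  shows "msg_entropy G S X \<le> (\<Sum>a\<in>inputs G S. g (X a)) / card (inputs G S)"
proof -
  let ?\<Omega> = "inputs G S"
  define P where "P y = card (X -` {y} \<inter> ?\<Omega>) / real (card ?\<Omega>)" for y
  have card: "card ?\<Omega> > 0" using fin ne by (simp add: card_gt_0_iff)
  have pos: "P y > 0" if "y \<in> X ` ?\<Omega>" for y
  proof -
    have "card (X -` {y} \<inter> ?\<Omega>) > 0" using that fin by (auto simp: card_gt_0_iff)
    then show ?thesis using card by (simp add: P_def)
  qed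
  have mean: "(\<Sum>a\<in>?\<Omega>. h (X a)) / card ?\<Omega> = (\<Sum>y\<in>X ` ?\<Omega>. P y * h y)" for h :: "nat \<Rightarrow> real"
  proof -
    have "(\<Sum>a\<in>?\<Omega>. h (X a)) = (\<Sum>y\<in>X ` ?\<Omega>. \<Sum>a\<in>{a\<in>?\<Omega>. X a = y}. h (X a))"
      using fin by (rule sum.image_gen)
    also have "\<dots> = (\<Sum>y\<in>X ` ?\<Omega>. card (X -` {y} \<inter> ?\<Omega>) * h y)"
    proof (rule sum.cong[OF refl])
      fix y
      have "{a\<in>?\<Omega>. X a = y} = X -` {y} \<inter> ?\<Omega>" by auto
      then show "(\<Sum>a\<in>{a\<in>?\<Omega>. X a = y}. h (X a)) = card (X -` {y} \<inter> ?\<Omega>) * h y" by simp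
    qed
    finally show ?thesis by (simp add: P_def sum_divide_distrib)
  qed
  have sum1: "(\<Sum>y\<in>X ` ?\<Omega>. P y) = 1"
    using mean[of "\<lambda>_. 1"] card by simp
  have "- (P y * log 2 (P y)) - P y * g y \<le> (2 powr (- g y) - P y) / ln 2" if "y \<in> X ` ?\<Omega>" for y
  proof -
    \<comment> \<open>The inequality \<open>ln x \<le> x - 1\<close> is applied to the ratio of the
      code's implicit probability to \<open>P y\<close>; after summation the right-hand sides are
      nonpositive by Kraft.\<close>
    have "ln (2 powr (- g y) / P y) \<le> 2 powr (- g y) / P y - 1"
      using pos[OF that] by (intro ln_le_minus_one) simp
    then have "- g y * ln 2 - ln (P y) \<le> 2 powr (- g y) / P y - 1"
      using pos[OF that] by (simp add: ln_div ln_powr)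
    then have "P y * (- g y * ln 2 - ln (P y)) \<le> P y * (2 powr (- g y) / P y - 1)"
      using pos[OF that] by (intro mult_left_mono) auto
    also have "\<dots> = 2 powr (- g y) - P y"
      using pos[OF that] by (simp add: field_simps)
    finally have "P y * (- g y * ln 2 - ln (P y)) / ln 2 \<le> (2 powr (- g y) - P y) / ln 2"
      by (rule divide_right_mono) simp
    moreover have "P y * (- g y * ln 2 - ln (P y)) / ln 2 = - (P y * log 2 (P y)) - P y * g y"
      by (simp add: log_def right_diff_distrib diff_divide_distrib)
    ultimately show ?thesis by linarith
  qed
  then have "(\<Sum>y\<in>X ` ?\<Omega>. - (P y * log 2 (P y)) - P y * g y)
      \<le> (\<Sum>y\<in>X ` ?\<Omega>. (2 powr (- g y) - P y) / ln 2)"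
    by (rule sum_mono)
  also have "\<dots> \<le> 0"
    using kraft sum1 by (simp add: sum_divide_distrib[symmetric] sum_subtractf divide_le_0_iff)
  finally have "- (\<Sum>y\<in>X ` ?\<Omega>. P y * log 2 (P y)) \<le> (\<Sum>y\<in>X ` ?\<Omega>. P y * g y)"
    by (simp add: sum_subtractf sum_negf)
  then show ?thesis
    unfolding mean[of g] msg_entropy_eq[OF fin ne, of X] P_def .
qed

text \<open>A constant code length \<open>c\<close> satisfies Kraft's inequality once there are at
  most \<open>2 powr c\<close> values.\<close>

lemma msg_entropy_le_log_card:
  assumes fin: "finite (inputs G S)" and ne: "inputs G S \<noteq> {}"
    and sub: "X ` inputs G S \<subseteq> Y" and Y: "finite Y" and card: "real (card Y) \<le> 2 powr c"
  shows "msg_entropy G S X \<le> c"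
proof -
  have "(\<Sum>y\<in>X ` inputs G S. 2 powr (- c)) \<le> 1"
  proof -
    have "real (card (X ` inputs G S)) \<le> 2 powr c"
      using card_mono[OF Y sub] card by linarith
    then have "real (card (X ` inputs G S)) * 2 powr (- c) \<le> 2 powr c * 2 powr (- c)"
      by (intro mult_right_mono) auto
    also have "\<dots> = 1" by (simp add: powr_minus)
    finally show ?thesis by simp
  qed
  from msg_entropy_le_mean_cost[where g = "\<lambda>_. c", OF fin ne this] show ?thesis
    using fin ne by simp
qed

text \<open>All fibres of a coordinate projection of a product set have the same size, so a single
  message is uniform on its \<open>2 ^ w\<close> values.\<close>

lemma msg_entropy_source:
  assumes i: "i < npairs G" and msgs: "\<And>j. j < npairs G \<Longrightarrow> messages S j = {..<2 ^ w}"
  shows "msg_entropy G S (\<lambda>a. a i) = real w"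
proof -
  let ?\<Omega> = "inputs G S"
  have \<Omega>: "?\<Omega> = PiE {..<npairs G} (\<lambda>_. {..<2 ^ w})"
    unfolding inputs_def by (rule PiE_cong) (simp add: msgs)
  have fin: "finite ?\<Omega>" unfolding \<Omega> by (intro finite_PiE) auto
  have ne: "?\<Omega> \<noteq> {}" unfolding \<Omega> by (auto simp: PiE_eq_empty_iff lessThan_empty_iff)
  have card: "card ?\<Omega> = (2 ^ w) ^ npairs G"
    unfolding \<Omega> by (simp add: card_PiE)
  have fib: "card ((\<lambda>a. a i) -` {y} \<inter> ?\<Omega>) = (2 ^ w) ^ (npairs G - 1)" if "y < 2 ^ w" for y
  proof -
    have "(\<lambda>a. a i) -` {y} \<inter> ?\<Omega> = PiE {..<npairs G} (\<lambda>j. if j = i then {y} else {..<2 ^ w})"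
      unfolding set_eq_iff
    proof
      fix a :: "nat \<Rightarrow> nat"
      have "(\<forall>j<npairs G. a j \<in> (if j = i then {y} else {..<2 ^ w})) \<longleftrightarrow> a i = y \<and> (\<forall>j<npairs G. a j \<in> {..<2 ^ w})"
        using i that by (metis insertI1 lessThan_iff singletonD)
      then show "a \<in> (\<lambda>a. a i) -` {y} \<inter> ?\<Omega> \<longleftrightarrow> a \<in> PiE {..<npairs G} (\<lambda>j. if j = i then {y} else {..<2 ^ w})"
        unfolding \<Omega> Int_iff vimage_singleton_eq PiE_iff Ball_def lessThan_iff[of _ "npairs G"] by blast
    qed
    then have "card ((\<lambda>a. a i) -` {y} \<inter> ?\<Omega>) = (\<Prod>j<npairs G. if j = i then 1 else 2 ^ w)"
      by (simp add: card_PiE if_distrib[of card] cong: if_cong)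
    also have "\<dots> = (\<Prod>j\<in>{..<npairs G} - {i}. 2 ^ w)"
      using i by (subst prod.remove[of _ i]) (auto intro!: prod.cong)
    finally show ?thesis using i by simp
  qed
  have img: "(\<lambda>a. a i) ` ?\<Omega> = {..<2 ^ w}"
  proof (intro equalityI subsetI)
    fix y :: nat assume "y \<in> {..<2 ^ w}"
    then have "(\<lambda>j\<in>{..<npairs G}. y) \<in> ?\<Omega>" "y = (\<lambda>j\<in>{..<npairs G}. y) i"
      using i unfolding \<Omega> by auto
    then show "y \<in> (\<lambda>a. a i) ` ?\<Omega>" by blast
  qed (use i in \<open>auto simp: \<Omega>\<close>)
  have "card ?\<Omega> = (2 ^ w) * (2 ^ w) ^ (npairs G - 1)"
    unfolding card using i by (cases "npairs G") auto
  then have P: "real (card ((\<lambda>a. a i) -` {y} \<inter> ?\<Omega>)) / card ?\<Omega> = 1 / 2 ^ w" if "y < 2 ^ w" for y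
    using fib[OF that] by simp
  have "log 2 (1 / 2 ^ w) = - real w"
    by (simp add: log_divide log_nat_power)
  then have "(\<Sum>y<2 ^ w. real (card ((\<lambda>a. a i) -` {y} \<inter> ?\<Omega>)) / card ?\<Omega> *
      log 2 (real (card ((\<lambda>a. a i) -` {y} \<inter> ?\<Omega>)) / card ?\<Omega>)) = (\<Sum>y<(2 :: nat) ^ w. 1 / 2 ^ w * (- real w))"
    using P by (intro sum.cong) auto
  also have "\<dots> = - real w" by simp
  finally show ?thesis
    unfolding msg_entropy_eq[OF fin ne] img by linarith
qed

subsection \<open>Distances in the discrete cube\<close>

text \<open>Averaging quadratic upper bounds for \<open>exp y\<close> and \<open>exp (- y)\<close>
  gives \<open>1 + y\<^sup>2\<close>. Compared with the sharp exponent \<open>x\<^sup>2 / 2\<close>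
  this loses only a constant factor.\<close>

lemma cosh_le_exp_square:
  fixes x :: real
  assumes "\<bar>x\<bar> \<le> 1"
  shows "cosh x \<le> exp (x\<^sup>2)"
proof -
  define y where "y = \<bar>x\<bar>"
  have y: "0 \<le> y" "y \<le> 1" using assms by (auto simp: y_def)
  have "exp (- y) \<le> 1 - y + y\<^sup>2"
  proof -
    \<comment> \<open>The bound on \<open>exp (- y)\<close> is obtained as a reciprocal: its product
      with the Taylor bound on \<open>exp y\<close> is at least \<open>1\<close>.\<close>
    have "(1 + y + y\<^sup>2 / 2) * (1 - y + y\<^sup>2) = 1 + y\<^sup>2 / 2 + y ^ 3 / 2 + y ^ 4 / 2"
      by (simp add: field_simps power2_eq_square power3_eq_cube power4_eq_xxxx)
    then have "1 \<le> (1 + y + y\<^sup>2 / 2) * (1 - y + y\<^sup>2)"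
      using y by simp
    also have "\<dots> \<le> exp y * (1 - y + y\<^sup>2)"
      using y exp_lower_Taylor_quadratic[OF y(1)] by (intro mult_right_mono) auto
    finally show ?thesis by (simp add: exp_minus field_simps)
  qed
  moreover have "exp y \<le> 1 + y + y\<^sup>2" using y by (rule exp_bound)
  ultimately have "cosh y \<le> 1 + y\<^sup>2" by (simp add: cosh_def)
  also have "\<dots> \<le> exp (y\<^sup>2)" by (rule exp_ge_add_one_self)
  finally show ?thesis by (simp add: y_def)
qed

text \<open>A Lipschitz function on the cube, represented by the subsets of \<open>I\<close>, is subgaussian: averaging
  over one coordinate at a time preserves the Lipschitz property.\<close>

lemma cube_mgf_le:
  fixes g :: "'a set \<Rightarrow> real" and t :: real
  assumes "finite I" and t: "0 \<le> t" "t \<le> 1"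
    and "\<And>X i. X \<subseteq> I \<Longrightarrow> i \<in> I \<Longrightarrow> i \<notin> X \<Longrightarrow> \<bar>g (insert i X) - g X\<bar> \<le> 1"
  shows "(\<Sum>X\<in>Pow I. exp (t * g X)) / 2 ^ card I
      \<le> exp (t * ((\<Sum>X\<in>Pow I. g X) / 2 ^ card I) + t\<^sup>2 / 4 * card I)"
  using assms(1,4)
proof (induction I arbitrary: g rule: finite_induct)
  case empty
  then show ?case by simp
next
  case (insert i I)
  have split: "(\<Sum>X\<in>Pow (insert i I). h X) = (\<Sum>X\<in>Pow I. h X + h (insert i X))" for h :: "'a set \<Rightarrow> real"
  proof -
    have "(\<Sum>X\<in>Pow (insert i I). h X) = (\<Sum>X\<in>Pow I. h X) + (\<Sum>X\<in>insert i ` Pow I. h X)"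
      unfolding Pow_insert using insert.hyps by (intro sum.union_disjoint) auto
    also have "(\<Sum>X\<in>insert i ` Pow I. h X) = (\<Sum>X\<in>Pow I. h (insert i X))"
      using insert.hyps by (subst sum.reindex) (auto simp: inj_on_def)
    finally show ?thesis by (simp add: sum.distrib)
  qed
  define m where "m X = (g X + g (insert i X)) / 2" for X
  have card: "card (insert i I) = Suc (card I)" using insert.hyps by simp
  have "exp (t * g X) + exp (t * g (insert i X)) \<le> 2 * (exp (t\<^sup>2 / 4) * exp (t * m X))" if "X \<in> Pow I" for X
  proof -
    \<comment> \<open>The two values of \<open>g\<close> lie symmetrically around
      \<open>m X\<close>, so their exponentials add up to \<open>2 * cosh d * exp (t * m X)\<close>,
      and the Lipschitz condition bounds \<open>d\<close>.\<close>
    define d where "d = t * (g (insert i X) - g X) / 2"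
    have "\<bar>g (insert i X) - g X\<bar> \<le> 1"
      using that insert.hyps by (intro insert.prems) auto
    then have d: "\<bar>d\<bar> \<le> t / 2"
      using t mult_left_mono[of "\<bar>g (insert i X) - g X\<bar>" 1 t] by (simp add: d_def abs_mult)
    have "exp (t * g X) + exp (t * g (insert i X)) = exp (t * m X - d) + exp (t * m X + d)"
      by (simp add: m_def d_def field_simps)
    also have "\<dots> = 2 * (cosh d * exp (t * m X))"
      by (simp add: cosh_def exp_add exp_diff exp_minus field_simps)
    also have "cosh d \<le> exp (d\<^sup>2)"
      using d t by (intro cosh_le_exp_square) auto
    also have "d\<^sup>2 \<le> t\<^sup>2 / 4"
      using power_mono[OF d, of 2] by (simp add: power_divide)
    finally show ?thesis by simp
  qed
  then have "(\<Sum>X\<in>Pow (insert i I). exp (t * g X)) \<le> (\<Sum>X\<in>Pow I. 2 * (exp (t\<^sup>2 / 4) * exp (t * m X)))"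
    unfolding split by (rule sum_mono)
  then have "(\<Sum>X\<in>Pow (insert i I). exp (t * g X)) / 2 ^ card (insert i I)
      \<le> exp (t\<^sup>2 / 4) * ((\<Sum>X\<in>Pow I. exp (t * m X)) / 2 ^ card I)"
    unfolding card sum_distrib_left[symmetric] by (simp add: field_simps)
  also have "(\<Sum>X\<in>Pow I. exp (t * m X)) / 2 ^ card I
      \<le> exp (t * ((\<Sum>X\<in>Pow I. m X) / 2 ^ card I) + t\<^sup>2 / 4 * card I)"
  proof (rule insert.IH)
    fix X j assume X: "X \<subseteq> I" "j \<in> I" "j \<notin> X"
    have "\<bar>g (insert j X) - g X\<bar> \<le> 1" "\<bar>g (insert j (insert i X)) - g (insert i X)\<bar> \<le> 1"
      using X insert.hyps by (auto intro!: insert.prems)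
    then show "\<bar>m (insert j X) - m X\<bar> \<le> 1"
      unfolding m_def insert_commute[of i j] by (simp add: abs_le_iff field_simps)
  qed
  also have "(\<Sum>X\<in>Pow I. m X) / 2 ^ card I = (\<Sum>X\<in>Pow (insert i I). g X) / 2 ^ card (insert i I)"
    unfolding split card m_def by (simp add: sum_divide_distrib[symmetric])
  finally show ?case
    unfolding card by (simp add: exp_add[symmetric] field_simps)
qed

text \<open>The moment bound is applied to \<open>- f\<close>. Members of \<Gamma> contribute
  \<open>1\<close> each to the exponential sum, so a large \<Gamma> is incompatible with a large
  mean of \<open>f\<close>. The parameter \<open>t\<close> balances the two error terms.\<close>

lemma cube_mean_distance_le:
  fixes f :: "'a set \<Rightarrow> real" and \<Gamma> :: "'a set set" and \<epsilon> t :: real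
  assumes I: "finite I" and lip: "\<And>X i. X \<subseteq> I \<Longrightarrow> i \<in> I \<Longrightarrow> i \<notin> X \<Longrightarrow> \<bar>f (insert i X) - f X\<bar> \<le> 1"
    and \<Gamma>: "\<Gamma> \<subseteq> Pow I" "\<And>X. X \<in> \<Gamma> \<Longrightarrow> f X = 0"
    and large: "real (card \<Gamma>) \<ge> 2 powr (card I * (1 - \<epsilon>))"
    and \<epsilon>: "0 \<le> \<epsilon>" and t: "0 < t" "t \<le> 1"
  shows "(\<Sum>X\<in>Pow I. f X) / 2 ^ card I \<le> (\<epsilon> / t + t / 4) * card I"
proof -
  define \<mu> where "\<mu> = (\<Sum>X\<in>Pow I. f X) / 2 ^ card I"
  have "(\<Sum>X\<in>Pow I. exp (t * - f X)) / 2 ^ card I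
      \<le> exp (t * ((\<Sum>X\<in>Pow I. - f X) / 2 ^ card I) + t\<^sup>2 / 4 * card I)"
    using t lip by (intro cube_mgf_le I) (auto simp: abs_minus_commute)
  then have "(\<Sum>X\<in>Pow I. exp (t * - f X)) / 2 ^ card I \<le> exp (- t * \<mu> + t\<^sup>2 / 4 * card I)"
    by (simp add: sum_negf \<mu>_def)
  moreover have "real (card \<Gamma>) \<le> (\<Sum>X\<in>Pow I. exp (t * - f X))"
  proof -
    have "real (card \<Gamma>) = (\<Sum>X\<in>\<Gamma>. exp (t * - f X))" using \<Gamma> by simp
    also have "\<dots> \<le> (\<Sum>X\<in>Pow I. exp (t * - f X))"
      using I \<Gamma> by (intro sum_mono2) auto
    finally show ?thesis .
  qed
  moreover have "2 powr (card I * (1 - \<epsilon>)) / 2 ^ card I = exp (- \<epsilon> * ln 2 * card I)"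
  proof -
    have "2 powr (card I * (1 - \<epsilon>)) / 2 ^ card I = 2 powr (card I * (1 - \<epsilon>) - card I)"
      by (simp add: powr_diff powr_realpow)
    also have "\<dots> = exp (- \<epsilon> * ln 2 * card I)" by (simp add: powr_def algebra_simps)
    finally show ?thesis .
  qed
  ultimately have "exp (- \<epsilon> * ln 2 * card I) \<le> exp (- t * \<mu> + t\<^sup>2 / 4 * card I)"
    using large by (smt (verit) divide_right_mono zero_le_power)
  then have *: "t * \<mu> \<le> \<epsilon> * ln 2 * card I + t\<^sup>2 / 4 * card I" by simp
  have "\<epsilon> * ln 2 * card I \<le> \<epsilon> * card I"
    using \<epsilon> ln_2_less_1 by (intro mult_right_mono mult_left_le) auto
  with * have "t * \<mu> \<le> \<epsilon> * card I + t\<^sup>2 / 4 * card I" by linarith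
  then have "\<mu> \<le> (\<epsilon> * card I + t\<^sup>2 / 4 * card I) / t"
    using t by (simp add: field_simps)
  also have "\<dots> = (\<epsilon> / t + t / 4) * card I"
    using t by (simp add: field_simps power2_eq_square)
  finally show ?thesis by (simp add: \<mu>_def)
qed

text \<open>The weights \<open>2 powr -6\<close> per element sum to
  \<open>(1 + 1 / 64) ^ card I\<close> by expanding the product, and \<open>1 / 40\<close> bit per
  position pays for this because \<open>(1 + 1 / 64) ^ 40 \<le> 2\<close>.\<close>

lemma kraft_weighted_subsets:
  assumes "finite I"
  shows "(\<Sum>X\<in>Pow I. 2 powr (- (6 * real (card X) + card I / 40))) \<le> (1 :: real)"
proof -
  have pow: "(1 + 1 / 64 :: real) ^ 40 \<le> 2"
    by (simp add: field_simps)
  have base: "1 + 1 / 64 \<le> (2 powr (1 / 40) :: real)"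
  proof -
    have "((1 + 1 / 64) ^ 40) powr (1 / 40) \<le> (2 :: real) powr (1 / 40)"
      using pow by (intro powr_mono2) auto
    moreover have "((1 + 1 / 64) ^ 40) powr (1 / 40) = ((1 + 1 / 64 :: real) powr 40) powr (1 / 40)"
      by (subst powr_numeral) auto
    ultimately show ?thesis by (simp only: powr_powr) simp
  qed
  have "(\<Sum>X\<in>Pow I. 2 powr (- (6 * real (card X) + card I / 40)))
      = (\<Sum>X\<in>Pow I. (\<Prod>x\<in>X. 1 / 64) * (\<Prod>x\<in>I - X. 1)) * (2 :: real) powr (- (card I / 40))"
    unfolding sum_distrib_right
  proof (intro sum.cong refl)
    fix X assume "X \<in> Pow I"
    have "(2 :: real) powr (- (6 * real (card X))) = (2 powr -6) powr (card X)"
      by (simp add: powr_powr)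
    also have "(2 :: real) powr -6 = 1 / 64" by (simp add: powr_minus)
    also have "(1 / 64 :: real) powr card X = (1 / 64) ^ card X" by (simp add: powr_realpow)
    finally show "(2 :: real) powr (- (6 * real (card X) + card I / 40))
        = (\<Prod>x\<in>X. 1 / 64) * (\<Prod>x\<in>I - X. 1) * 2 powr (- (card I / 40))"
      by (simp only: minus_add_distrib powr_add prod_constant power_one mult_1_right)
  qed
  also have "(\<Sum>X\<in>Pow I. (\<Prod>x\<in>X. 1 / 64) * (\<Prod>x\<in>I - X. 1)) = (1 / 64 + 1 :: real) ^ card I"
    using prod_add[OF assms, of "\<lambda>_. 1 / 64 :: real" "\<lambda>_. 1"] by simp
  also have "\<dots> \<le> (2 powr (1 / 40)) ^ card I"
    using base by (intro power_mono) auto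
  also have "(2 powr (1 / 40)) ^ card I = (2 :: real) powr (card I / 40)"
    by (simp add: powr_powr powr_realpow[symmetric])
  also have "\<dots> * 2 powr (- (card I / 40)) = (1 :: real)"
    by (simp add: powr_add[symmetric])
  finally show ?thesis by (simp add: mult_right_mono)
qed

subsection \<open>Block versions in an external memory run\<close>

text \<open>\<open>Halt\<close> gets the dummy address \<open>0\<close>. It leaves the disk alone,
  so it can be treated as an access that keeps the contents of block \<open>0\<close>.\<close>

fun address :: "action \<Rightarrow> nat" where
  "address Halt = 0"
| "address (Read d p) = d"
| "address (Write d p) = d"

lemma perform_other:
  "d \<noteq> address (snd x) \<Longrightarrow> snd (perform B x D) d = D d"
  by (cases x; cases "snd x") auto

text \<open>Locality of a step: a network node can carry it out after receiving only the block that
  it accesses.\<close>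

lemma perform_cong:
  assumes "D (address (snd x)) = D' (address (snd x))"
  shows "fst (perform B x D) = fst (perform B x D')"
    and "snd (perform B x D) (address (snd x)) = snd (perform B x D') (address (snd x))"
  using assms by (cases x; cases "snd x"; auto)+

text \<open>Blocks are versioned: version \<open>v < K\<close> is the input block at address \<open>v\<close>, and step \<open>t\<close>, whether
  it reads or writes, turns the block at its address \<open>ad t\<close> into version \<open>K + t\<close>. So every version
  is accessed by at most one step. Unused addresses have no version.\<close>

primrec version :: "nat \<Rightarrow> (nat \<Rightarrow> nat) \<Rightarrow> nat \<Rightarrow> nat \<Rightarrow> nat option" where
  "version K ad 0 d = (if d < K then Some d else None)"
| "version K ad (Suc t) d = (if d = ad t then Some (K + t) else version K ad t d)"

lemma version_less: "version K ad t d = Some v \<Longrightarrow> v < K + t"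
  by (induction t) (fastforce split: if_splits)+

lemma version_inj:
  "version K ad t d = Some v \<Longrightarrow> version K ad t d' = Some v \<Longrightarrow> d = d'"
proof (induction t)
  case (Suc t)
  then show ?case using version_less[of K ad t d v] version_less[of K ad t d' v]
    by (auto split: if_splits)
qed (auto split: if_splits)

text \<open>The access replaces the version at its only address, and step \<open>i\<close> and all
  later steps create larger version numbers, so a consumed version never reappears.\<close>

lemma version_accessed:
  assumes "version K ad i (ad i) = Some v" and "i < t"
  shows "version K ad t d \<noteq> Some v"
  using \<open>i < t\<close>
proof (induction t)
  case (Suc t)
  have v: "v < K + i" using assms(1) by (rule version_less)
  show ?case
  proof (cases "t = i")
    case True
    then show ?thesis using v version_inj[OF assms(1), of d] by auto
  next
    case False
    then show ?thesis using v Suc by auto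
  qed
qed simp

lemma version_accessed_inj:
  assumes "version K ad i (ad i) = Some v" and "version K ad j (ad j) = Some v"
  shows "i = j"
  using version_accessed[OF assms(1), of j "ad j"] version_accessed[OF assms(2), of i "ad i"] assms
  by (cases i j rule: linorder_cases) auto

text \<open>Addresses are unbounded, so a run cannot be described by listing them. The description
  records only where an access falls inside the output area.\<close>

definition window :: "nat \<Rightarrow> nat \<Rightarrow> nat \<Rightarrow> nat option" where
  "window out K d = (if out \<le> d \<and> d < out + K then Some (d - out) else None)"

text \<open>Windows reveal which steps access output block \<open>k\<close>, and these steps
  determine its current version.\<close>

lemma version_window_cong:
  assumes "\<And>i. i < t \<Longrightarrow> window out K (ad i) = window out K (ad' i)" and k: "k < K"
  shows "version K ad t (out + k) = version K ad' t (out + k)"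
  using assms(1)
proof (induction t)
  case (Suc t)
  have "window out K (ad t) = window out K (ad' t)" by (rule Suc.prems) simp
  then have "out + k = ad t \<longleftrightarrow> out + k = ad' t"
    using k by (auto simp: window_def split: if_splits)
  with Suc show ?case by simp
qed simp

definition access :: "nat \<Rightarrow> nat \<Rightarrow> algorithm \<Rightarrow> disk \<Rightarrow> nat \<Rightarrow> nat" where
  "access M B alg D t = address (snd (alg t (fst (run M B alg D t))))"

text \<open>\<open>Suc\<close> appears because version \<open>K + t\<close> is the block as step
  \<open>t\<close> leaves it.\<close>

definition contents :: "nat \<Rightarrow> nat \<Rightarrow> algorithm \<Rightarrow> disk \<Rightarrow> nat \<Rightarrow> nat \<Rightarrow> nat list" where
  "contents M B alg D K v =
    (if v < K then D v else snd (run M B alg D (Suc (v - K))) (access M B alg D (v - K)))"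

lemma run_Suc: "run M B alg D (Suc t) = perform B (alg t (fst (run M B alg D t))) (snd (run M B alg D t))"
  by (simp add: case_prod_beta)

text \<open>A step changes only the block it accesses; \<open>Z\<close> is what an address outside
  the input holds as long as it is untouched.\<close>

lemma disk_eq_contents:
  assumes "\<And>d. d \<ge> K \<Longrightarrow> D d = Z"
  shows "snd (run M B alg D t) d =
    (case version K (access M B alg D) t d of None \<Rightarrow> Z | Some v \<Rightarrow> contents M B alg D K v)"
proof (induction t)
  case 0
  then show ?case using assms by (simp add: contents_def)
next
  case (Suc t)
  show ?case
  proof (cases "d = access M B alg D t")
    case True
    then show ?thesis by (simp add: contents_def del: run.simps)
  next
    case False
    then have "snd (run M B alg D (Suc t)) d = snd (run M B alg D t) d"
      unfolding run_Suc by (intro perform_other) (simp add: access_def)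
    with False Suc show ?thesis by simp
  qed
qed

lemma finite_word_lists: "finite (word_lists w k)"
  and card_word_lists: "card (word_lists w k) = 2 ^ (w * k)"
proof -
  have "word_lists w k = {xs. set xs \<subseteq> {..<2 ^ w} \<and> length xs = k}"
    by (auto simp: word_lists_def)
  then show "finite (word_lists w k)" "card (word_lists w k) = 2 ^ (w * k)"
    using finite_lists_length_eq[of "{..<2 ^ w :: nat}" k] card_lists_length_eq[of "{..<2 ^ w :: nat}" k]
    by (simp_all add: power_mult)
qed

lemma run_word_lists:
  assumes valid: "valid_algorithm M B w alg" and D: "\<And>d. D d \<in> word_lists w B"
  shows "fst (run M B alg D t) \<in> word_lists w M \<and> (\<forall>d. snd (run M B alg D t) d \<in> word_lists w B)"
proof (induction t)
  case 0
  then show ?case using D by (simp add: word_lists_def set_replicate_conv_if)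
next
  case (Suc t)
  define s D' where "s = fst (run M B alg D t)" and "D' = snd (run M B alg D t)"
  have IH: "s \<in> word_lists w M" "\<And>d. D' d \<in> word_lists w B"
    using Suc by (auto simp: s_def D'_def)
  obtain s' act where alg: "alg t s = (s', act)" by fastforce
  have v: "s' \<in> word_lists w M"
      "case act of Halt \<Rightarrow> True | Read d p \<Rightarrow> p + B \<le> M | Write d p \<Rightarrow> p + B \<le> M"
    using valid IH(1) alg unfolding valid_algorithm_def by (metis fst_conv snd_conv)+
  have run: "run M B alg D (Suc t) = perform B (s', act) D'"
    unfolding run_Suc s_def[symmetric] D'_def[symmetric] alg ..
  show ?case
  proof (cases act)
    case Halt
    then show ?thesis unfolding run using v IH by simp
  next
    case (Read d p)
    have "set (take p s') \<subseteq> {..<2 ^ w}" "set (drop (p + B) s') \<subseteq> {..<2 ^ w}"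
      using v(1) set_take_subset[of p s'] set_drop_subset[of "p + B" s'] by (auto simp: word_lists_def)
    then show ?thesis unfolding run using v IH(2)[of d] IH(2) Read by (simp add: word_lists_def)
  next
    case (Write d p)
    have "set (take B (drop p s')) \<subseteq> {..<2 ^ w}"
      using v(1) set_take_subset[of B "drop p s'"] set_drop_subset[of p s'] by (auto simp: word_lists_def)
    then show ?thesis unfolding run using v IH(2) Write by (simp add: word_lists_def)
  qed
qed

subsection \<open>Balls in the routing network\<close>

text \<open>The network is contracted to clusters: \<open>Inl k\<close> is the input block \<open>k\<close>, and \<open>Inr p\<close> consists of
  the \<open>q\<close> steps \<open>p * q, \<dots>, p * q + q - 1\<close> together with the block versions that they produce.\<close>

type_synonym cluster = "nat + nat"

text \<open>\<open>pv i\<close> is the version accessed by step \<open>i\<close>, and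
  \<open>fv k\<close> is the final version of output block \<open>k\<close>; \<open>None\<close>
  stands for an address without a version. The injectivity of \<open>pv\<close> bounds the
  degrees.\<close>

locale routing =
  fixes K q :: nat and pv fv :: "nat \<Rightarrow> nat option"
  assumes q_pos: "q \<ge> 1"
    and pv_inj: "\<And>i j v. pv i = Some v \<Longrightarrow> pv j = Some v \<Longrightarrow> i = j"
    and fv_inj: "\<And>k l v. fv k = Some v \<Longrightarrow> fv l = Some v \<Longrightarrow> k = l"
begin

definition version_cluster :: "nat \<Rightarrow> cluster" where
  "version_cluster v = (if v < K then Inl v else Inr ((v - K) div q))"

definition phase :: "nat \<Rightarrow> nat set" where
  "phase p = {i. i div q = p}"

lemma phase_eq: "phase p = {p * q..<p * q + q}"
proof -
  have "i div q = p \<longleftrightarrow> p * q \<le> i \<and> i < p * q + q" for i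
  proof -
    have "i div q = p \<longleftrightarrow> p \<le> i div q \<and> i div q < Suc p" by linarith
    moreover have "p \<le> i div q \<longleftrightarrow> p * q \<le> i"
      using q_pos by (intro less_eq_div_iff_mult_less_eq) simp
    moreover have "i div q < Suc p \<longleftrightarrow> i < Suc p * q"
      using q_pos by (intro div_less_iff_less_mult) simp
    ultimately show ?thesis by (simp add: add.commute)
  qed
  then show ?thesis unfolding phase_def set_eq_iff mem_Collect_eq atLeastLessThan_iff by blast
qed

lemma finite_phase: "finite (phase p)" and card_phase: "card (phase p) = q"
  by (simp_all add: phase_eq)

text \<open>An over-approximation of adjacency: \<open>p - 1\<close> is \<open>0\<close> for
  \<open>p = 0\<close>, and \<open>the (pv i)\<close> is arbitrary if step \<open>i\<close> accesses
  an unversioned block. Extra neighbours can only enlarge the balls.\<close>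

definition neighbours :: "cluster \<Rightarrow> cluster set" where
  "neighbours c = (case c of
     Inl k \<Rightarrow> (\<lambda>j. Inr (j div q)) ` {j. pv j = Some k}
   | Inr p \<Rightarrow> {Inr (p - 1), Inr (Suc p)} \<union> (\<lambda>i. version_cluster (the (pv i))) ` phase p
       \<union> (\<lambda>j. Inr (j div q)) ` {j. \<exists>i\<in>phase p. pv j = Some (K + i)})"

lemma neighbours_read:
  assumes "pv j = Some v"
  shows "Inr (j div q) \<in> neighbours (version_cluster v)"
    and "version_cluster v \<in> neighbours (Inr (j div q))"
proof -
  show "Inr (j div q) \<in> neighbours (version_cluster v)"
  proof (cases "v < K")
    case False
    then have "v - K \<in> phase ((v - K) div q)" "pv j = Some (K + (v - K))"
      using assms by (auto simp: phase_def)
    then have "j \<in> {j. \<exists>i\<in>phase ((v - K) div q). pv j = Some (K + i)}" by blast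
    then show ?thesis
      unfolding neighbours_def version_cluster_def if_not_P[OF False] sum.case by blast
  qed (use assms in \<open>auto simp: neighbours_def version_cluster_def\<close>)
  have "j \<in> phase (j div q)" by (simp add: phase_def)
  then show "version_cluster v \<in> neighbours (Inr (j div q))"
    using assms unfolding neighbours_def sum.case by (metis (no_types, lifting) UnI1 UnI2 image_eqI option.sel)
qed

lemma neighbours_next: "Inr (Suc p) \<in> neighbours (Inr p)" "Inr p \<in> neighbours (Inr (Suc p))"
  by (auto simp: neighbours_def)

text \<open>A phase has two adjacent phases, its \<open>q\<close> steps access at most
  \<open>q\<close> versions, and the \<open>q\<close> versions it produces are accessed by at most
  \<open>q\<close> steps because \<open>pv\<close> is injective.\<close>

lemma finite_neighbours: "finite (neighbours c)" and card_neighbours: "card (neighbours c) \<le> 4 * q"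
proof -
  have "finite (neighbours c) \<and> card (neighbours c) \<le> 4 * q"
  proof (cases c)
    case (Inl k)
    have "finite {j. pv j = Some k} \<and> card {j. pv j = Some k} \<le> 1"
    proof (cases "\<exists>j. pv j = Some k")
      case True
      then obtain j where "pv j = Some k" by blast
      then have "{j. pv j = Some k} = {j}" by (blast intro: pv_inj)
      then show ?thesis by simp
    qed simp
    then show ?thesis using q_pos card_image_le[of "{j. pv j = Some k}" "\<lambda>j. Inr (j div q) :: cluster"]
      unfolding neighbours_def Inl by simp
  next
    case (Inr p)
    let ?R = "{j. \<exists>i\<in>phase p. pv j = Some (K + i)}"
    have inj: "inj_on (\<lambda>j. the (pv j) - K) ?R"
      by (rule inj_onI) (auto intro: pv_inj)
    have sub: "(\<lambda>j. the (pv j) - K) ` ?R \<subseteq> phase p" by auto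
    have R: "finite ?R" "card ?R \<le> q"
      using inj_on_finite[OF inj sub finite_phase] card_inj_on_le[OF inj sub finite_phase] card_phase
      by auto
    have "card ({Inr (p - 1), Inr (Suc p)} \<union> (\<lambda>i. version_cluster (the (pv i))) ` phase p
        \<union> (\<lambda>j. Inr (j div q)) ` ?R) \<le> 2 + q + q"
      using card_phase[of p] R card_image_le[OF finite_phase, of "\<lambda>i. version_cluster (the (pv i))" p]
        card_image_le[OF R(1), of "\<lambda>j. Inr (j div q) :: cluster"]
      by (intro order_trans[OF card_Un_le] add_mono) (auto simp: card_insert_if)
    then show ?thesis using q_pos R(1) finite_phase unfolding neighbours_def Inr by simp
  qed
  then show "finite (neighbours c)" "card (neighbours c) \<le> 4 * q" by auto
qed

section \<open>Balls and truncated distances between clusters\<close>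

primrec ball :: "cluster \<Rightarrow> nat \<Rightarrow> cluster set" where
  "ball c 0 = {c}"
| "ball c (Suc d) = ball c d \<union> (\<Union>c'\<in>ball c d. neighbours c')"

lemma finite_ball: "finite (ball c d)"
  by (induction d) (auto simp: finite_neighbours)

lemma card_ball: "card (ball c d) \<le> (4 * q + 1) ^ d"
proof (induction d)
  case (Suc d)
  have "card (ball c (Suc d)) \<le> card (ball c d) + (\<Sum>c'\<in>ball c d. card (neighbours c'))"
    unfolding ball.simps
    by (rule order_trans[OF card_Un_le add_left_mono[OF card_UN_le[OF finite_ball]]])
  also have "\<dots> \<le> card (ball c d) + (\<Sum>c'\<in>ball c d. 4 * q)"
    by (intro add_left_mono sum_mono card_neighbours)
  also have "\<dots> = card (ball c d) * (4 * q + 1)" by simp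
  also have "\<dots> \<le> (4 * q + 1) ^ d * (4 * q + 1)" using Suc by (rule mult_right_mono) simp
  finally show ?case by (simp add: mult.commute)
qed simp

lemma ball_mono: "d \<le> d' \<Longrightarrow> ball c d \<subseteq> ball c d'"
  by (induction rule: dec_induct) auto

text \<open>Balls are nested, so counting the radii whose ball misses \<open>c'\<close> yields the
  distance truncated at \<open>L\<close>, also for unreachable \<open>c'\<close>.\<close>

definition capped_dist :: "nat \<Rightarrow> cluster \<Rightarrow> cluster \<Rightarrow> nat" where
  "capped_dist L c c' = card {d. d < L \<and> c' \<notin> ball c d}"

lemma capped_dist_le: "capped_dist L c c' \<le> L"
  using card_mono[of "{..<L}" "{d. d < L \<and> c' \<notin> ball c d}"] by (auto simp: capped_dist_def)

lemma capped_dist_self: "capped_dist L c c = 0"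
proof -
  have "c \<in> ball c d" for d using ball_mono[of 0 d c] by auto
  then show ?thesis by (simp add: capped_dist_def)
qed

lemma capped_dist_far:
  assumes "c' \<notin> ball c (L - 1)"
  shows "capped_dist L c c' = L"
proof -
  have "c' \<notin> ball c d" if "d < L" for d
  proof -
    have "d \<le> L - 1" using that by linarith
    then show ?thesis using assms ball_mono[of d "L - 1" c] by blast
  qed
  then have "{d. d < L \<and> c' \<notin> ball c d} = {..<L}" by auto
  then show ?thesis by (simp add: capped_dist_def)
qed

lemma capped_dist_neighbour:
  assumes "b \<in> neighbours a"
  shows "capped_dist L c b \<le> Suc (capped_dist L c a)"
proof -
  let ?A = "\<lambda>x. {d. d < L \<and> x \<notin> ball c d}"
  \<comment> \<open>If the ball of radius \<open>Suc d\<close> misses \<open>b\<close>, then the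
    ball of radius \<open>d\<close> misses its neighbour \<open>a\<close>; the radius
    \<open>0\<close> is the possible extra one.\<close>
  have "d \<in> insert 0 (Suc ` ?A a)" if "d \<in> ?A b" for d
    using that assms by (cases d) auto
  then have "card (?A b) \<le> card (insert 0 (Suc ` ?A a))"
    by (intro card_mono) auto
  also have "\<dots> \<le> Suc (card (Suc ` ?A a))" by (simp add: card_insert_if)
  also have "card (Suc ` ?A a) = card (?A a)" by (simp add: card_image)
  finally show ?thesis by (simp add: capped_dist_def)
qed

lemma capped_dist_lipschitz:
  assumes "b \<in> neighbours a" "a \<in> neighbours b"
  shows "\<bar>real (capped_dist L c b) - real (capped_dist L c a)\<bar> \<le> 1"
  using capped_dist_neighbour[OF assms(1), of L c] capped_dist_neighbour[OF assms(2), of L c] by linarith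

text \<open>A cluster holds at most \<open>q\<close> versions, and each version is final for at most
  one output block.\<close>

lemma card_near_outputs:
  shows "finite {k. \<exists>v. fv k = Some v \<and> version_cluster v \<in> ball c d}" (is "finite ?N")
    and "card {k. \<exists>v. fv k = Some v \<and> version_cluster v \<in> ball c d} \<le> q * (4 * q + 1) ^ d"
proof -
  define V where "V c' = (case c' of Inl k \<Rightarrow> {k} | Inr p \<Rightarrow> (+) K ` phase p)" for c' :: cluster
  have V: "v \<in> V (version_cluster v)" for v
  proof (cases "v < K")
    case False
    then have "v = K + (v - K)" "v - K \<in> phase ((v - K) div q)" by (auto simp: phase_def)
    then have "v \<in> (+) K ` phase ((v - K) div q)" by (rule image_eqI)
    then show ?thesis using False unfolding V_def version_cluster_def by simp
  qed (simp add: V_def version_cluster_def)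
  have finV: "finite (V c')" for c' by (cases c') (auto simp: V_def finite_phase)
  have cardV: "card (V c') \<le> q" for c'
    using q_pos card_image_le[OF finite_phase, of "(+) K"] card_phase by (cases c') (auto simp: V_def)
  have inj: "inj_on (\<lambda>k. the (fv k)) ?N" by (rule inj_onI) (auto intro: fv_inj)
  have sub: "(\<lambda>k. the (fv k)) ` ?N \<subseteq> (\<Union>c'\<in>ball c d. V c')" using V by fastforce
  have fin: "finite (\<Union>c'\<in>ball c d. V c')" using finV finite_ball by auto
  show "finite ?N" by (rule inj_on_finite[OF inj sub fin])
  have "card ?N \<le> card (\<Union>c'\<in>ball c d. V c')" by (rule card_inj_on_le[OF inj sub fin])
  also have "\<dots> \<le> (\<Sum>c'\<in>ball c d. card (V c'))" by (rule card_UN_le[OF finite_ball])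
  also have "\<dots> \<le> (\<Sum>c'\<in>ball c d. q)" by (rule sum_mono[OF cardV])
  also have "\<dots> \<le> q * (4 * q + 1) ^ d" using card_ball[of c d] by simp
  finally show "card ?N \<le> q * (4 * q + 1) ^ d" .
qed

end

subsection \<open>The network coding solution\<close>

text \<open>\<open>Src k\<close> holds the messages of input block \<open>k\<close>,
  \<open>Ver v\<close> a block version, \<open>Mem i\<close> carries out step \<open>i\<close>,
  \<open>Out k\<close> restores output block \<open>k\<close>, and \<open>Hub\<close> distributes
  the corrections.\<close>

datatype node = Hub | Src nat | Ver nat | Mem nat | Out nat

instance node :: countable
  by countable_datatype

definition flat_disk :: "nat \<Rightarrow> nat \<Rightarrow> (nat \<Rightarrow> nat) \<Rightarrow> disk" where
  "flat_disk B K a d = (if d < K then map (\<lambda>l. a (d * B + l)) [0..<B] else replicate B 0)"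

definition flip_bits :: "nat \<Rightarrow> nat set \<Rightarrow> nat" where
  "flip_bits x S = set_encode (sym_diff (set_decode x) S)"

definition encode_bits :: "(nat \<times> nat) set \<Rightarrow> nat" where
  "encode_bits X = set_encode (prod_encode ` X)"

definition decode_bits :: "nat \<Rightarrow> (nat \<times> nat) set" where
  "decode_bits m = prod_decode ` set_decode m"

lemma decode_encode_bits: "finite X \<Longrightarrow> decode_bits (encode_bits X) = X"
  by (simp add: decode_bits_def encode_bits_def image_image)

lemma set_decode_subset: "x < 2 ^ w \<Longrightarrow> set_decode x \<subseteq> {..<w}"
proof
  fix b assume x: "x < 2 ^ w" and b: "b \<in> set_decode x"
  have "2 ^ b = set_encode {b}" by (simp add: set_encode_def)
  also have "\<dots> \<le> x"
    using b by (intro subset_decode_imp_le) (simp add: set_encode_inverse del: set_encode_insert)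
  finally have "(2::nat) ^ b < 2 ^ w" using x by (rule le_less_trans)
  then show "b \<in> {..<w}" by simp
qed

definition words :: "nat \<Rightarrow> nat \<Rightarrow> (nat \<Rightarrow> nat) set" where
  "words N w = PiE {..<N} (\<lambda>_. {..<2 ^ w})"

lemma finite_words: "finite (words N w)" and words_nonempty: "words N w \<noteq> {}"
  unfolding words_def by (auto intro!: finite_PiE simp: PiE_eq_empty_iff lessThan_empty_iff)

lemma sum_union_le:
  fixes h :: "'a \<Rightarrow> real"
  assumes "finite A" "finite B" "\<And>x. h x \<ge> 0"
  shows "sum h (A \<union> B) \<le> sum h A + sum h B"
  using sum.union_inter[of A B h] sum_nonneg[of "A \<inter> B" h] assms by auto

text \<open>A deterministic algorithm on a set \<Gamma> of inputs whose runs share the access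
  pattern given by \<open>pv\<close> and \<open>fv\<close>. The involution \<sigma> sends an entry
  to its position in the output, and \<open>near\<close> picks the member of \<Gamma> on which the
  algorithm is run instead of \<open>a\<close>.\<close>

locale coding_network = routing +
  fixes alg :: algorithm and M out w B N T :: nat and \<sigma> :: "nat \<Rightarrow> nat"
    and \<Gamma> :: "(nat \<Rightarrow> nat) set" and near :: "(nat \<Rightarrow> nat) \<Rightarrow> nat \<Rightarrow> nat"
  assumes valid: "valid_algorithm M B w alg"
    and w_pos: "w \<ge> 1" and B_pos: "B \<ge> 1" and B_le_M: "B \<le> M" and N: "N = K * B"
    and \<sigma>_less: "\<And>p. p < N \<Longrightarrow> \<sigma> p < N" and \<sigma>_\<sigma>: "\<And>p. p < N \<Longrightarrow> \<sigma> (\<sigma> p) = p"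
    and pv_less: "\<And>j v. pv j = Some v \<Longrightarrow> v < K + j"
    and fv_less: "\<And>k v. fv k = Some v \<Longrightarrow> v < K + T"
    and \<Gamma>: "\<Gamma> \<subseteq> words N w" and near: "\<And>a. a \<in> words N w \<Longrightarrow> near a \<in> \<Gamma>"
    and reads: "\<And>g i. g \<in> \<Gamma> \<Longrightarrow> i < T \<Longrightarrow>
      version K (access M B alg (flat_disk B K g)) i (access M B alg (flat_disk B K g) i) = pv i"
    and writes: "\<And>g k. g \<in> \<Gamma> \<Longrightarrow> k < K \<Longrightarrow>
      version K (access M B alg (flat_disk B K g)) T (out + k) = fv k"
    and transposed: "\<And>g k. g \<in> \<Gamma> \<Longrightarrow> k < K \<Longrightarrow>
      snd (run M B alg (flat_disk B K g) T) (out + k) = map (\<lambda>l. g (\<sigma> (k * B + l))) [0..<B]"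
begin

fun link :: "node \<Rightarrow> node \<Rightarrow> bool" where
  "link (Src k) Hub \<longleftrightarrow> k < K"
| "link (Src k) (Ver v) \<longleftrightarrow> k < K \<and> v = k"
| "link Hub (Ver v) \<longleftrightarrow> v < K"
| "link Hub (Out k) \<longleftrightarrow> k < K"
| "link (Mem i) (Mem j) \<longleftrightarrow> j = Suc i \<and> j < T"
| "link (Mem i) (Ver v) \<longleftrightarrow> i < T \<and> v = K + i"
| "link (Ver v) (Mem j) \<longleftrightarrow> j < T \<and> pv j = Some v"
| "link (Ver v) (Out k) \<longleftrightarrow> k < K \<and> fv k = Some v"
| "link _ _ \<longleftrightarrow> False"

definition nodes :: "node set" where
  "nodes = {Hub} \<union> Src ` {..<K} \<union> Ver ` {..<K + T} \<union> Mem ` {..<T} \<union> Out ` {..<K}"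

definition correction :: "(nat \<Rightarrow> nat) \<Rightarrow> (nat \<times> nat) set" where
  "correction a = {(p, b). p < N \<and> (b \<in> set_decode (a p)) \<noteq> (b \<in> set_decode (near a p))}"

definition correction_in :: "nat \<Rightarrow> (nat \<Rightarrow> nat) \<Rightarrow> (nat \<times> nat) set" where
  "correction_in k a = {(p, b) \<in> correction a. p div B = k}"

definition correction_out :: "nat \<Rightarrow> (nat \<Rightarrow> nat) \<Rightarrow> (nat \<times> nat) set" where
  "correction_out k a = {(p, b) \<in> correction a. \<sigma> p div B = k}"

definition mean :: "((nat \<Rightarrow> nat) \<Rightarrow> nat) \<Rightarrow> real" where
  "mean f = (\<Sum>a\<in>words N w. real (f a)) / card (words N w)"

text \<open>The corrections are cheap because few bits are flipped on average. Their capacity is the mean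
  length of a code that spends \<open>1/40\<close> bit on every position and \<open>6\<close> bits on every flipped one.\<close>

fun node_cap :: "node \<Rightarrow> node \<Rightarrow> real" where
  "node_cap Hub (Ver k) = 6 * mean (\<lambda>a. card (correction_in k a)) + B * w / 40"
| "node_cap Hub (Out k) = 6 * mean (\<lambda>a. card (correction_out k a)) + B * w / 40"
| "node_cap (Mem i) (Mem j) = M * w"
| "node_cap _ _ = B * w"

abbreviation nd :: "node \<Rightarrow> nat" where "nd \<equiv> to_nat"

text \<open>Every matrix entry is a commodity of its own, and the entries of a block share their
  source node. The conjecture speaks of vertices in \<open>nat\<close>, hence the encoding
  \<open>nd\<close>.\<close>

definition network :: "nat k_pairs" where
  "network = \<lparr>verts = nd ` nodes, edges = {(nd u, nd v) | u v. link u v},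
     cap = (\<lambda>(x, y). node_cap (from_nat x) (from_nat y)), npairs = N,
     source = (\<lambda>p. nd (Src (p div B))), sink = (\<lambda>p. nd (Out (\<sigma> p div B)))\<rparr>"

lemma network_simps [simp]:
  "verts network = nd ` nodes"
  "(nd u, nd v) \<in> edges network \<longleftrightarrow> link u v"
  "cap network (nd u, nd v) = node_cap u v"
  "npairs network = N"
  "source network p = nd (Src (p div B))"
  "sink network p = nd (Out (\<sigma> p div B))"
  by (auto simp: network_def)

lemma edges_network: "edges network = (\<lambda>(u, v). (nd u, nd v)) ` {(u, v). link u v}"
  by (auto simp: network_def)

lemma link_nodes: "link u v \<Longrightarrow> u \<in> nodes \<and> v \<in> nodes"
  using pv_less fv_less
  by (induction u v rule: link.induct) (fastforce simp: nodes_def)+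

lemma finite_nodes: "finite nodes"
  by (simp add: nodes_def)

lemma finite_links: "finite {(u, v). link u v}"
  by (rule finite_subset[of _ "nodes \<times> nodes"]) (auto simp: link_nodes finite_nodes)

lemma div_less_K: "p < N \<Longrightarrow> p div B < K"
  using B_pos by (simp add: N div_less_iff_less_mult)

text \<open>A topological order by time: step \<open>i\<close> has rank \<open>2 * i + 3\<close>,
  and the version it produces comes right after it. It shows that the network is acyclic.\<close>

fun rank :: "node \<Rightarrow> nat" where
  "rank (Src k) = 0"
| "rank Hub = 1"
| "rank (Ver v) = (if v < K then 2 else 2 * (v - K) + 4)"
| "rank (Mem i) = 2 * i + 3"
| "rank (Out k) = 2 * T + 4"

lemma link_rank: "link u v \<Longrightarrow> rank u < rank v"
  using pv_less fv_less
  by (induction u v rule: link.induct) fastforce+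

lemma mean_nonneg: "mean f \<ge> 0"
  by (simp add: mean_def sum_nonneg)

lemma node_cap_pos: "node_cap u v > 0"
  using w_pos B_pos B_le_M
  by (induction u v rule: node_cap.induct) (auto intro!: add_nonneg_pos mean_nonneg)

lemma k_pairs_instance_network: "k_pairs_instance network"
  unfolding k_pairs_instance_def
proof (intro conjI)
  have "edges network \<subseteq> inv_image less_than (\<lambda>x. rank (from_nat x))"
    using link_rank by (auto simp: edges_network)
  then have "wf (edges network)" by (rule wf_subset[rotated]) simp
  then show "acyclic (edges network)" by (rule wf_acyclic)
  show "finite (verts network)" by (simp add: finite_nodes)
  show "edges network \<subseteq> verts network \<times> verts network"
    using link_nodes by (auto simp: edges_network)
  show "\<forall>e\<in>edges network. cap network e > 0"
    by (auto simp: edges_network node_cap_pos)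
  show "\<forall>i<npairs network. source network i \<in> verts network \<and> sink network i \<in> verts network \<and>
      source network i \<noteq> sink network i"
    using div_less_K \<sigma>_less by (auto simp: nodes_def)
qed

section \<open>Intended messages and the local functions that compute them\<close>

abbreviation input :: "(nat \<Rightarrow> nat) \<Rightarrow> disk" where
  "input a \<equiv> flat_disk B K (near a)"

text \<open>The global view of what each link should carry when the algorithm runs on
  \<open>near a\<close>; \<open>send\<close> has to compute the same from the in-edges.\<close>

fun msg :: "(nat \<Rightarrow> nat) \<Rightarrow> node \<Rightarrow> node \<Rightarrow> nat" where
  "msg a (Src k) v = list_encode (map (\<lambda>l. a (k * B + l)) [0..<B])"
| "msg a Hub (Ver k) = encode_bits (correction_in k a)"
| "msg a Hub (Out k) = encode_bits (correction_out k a)"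
| "msg a (Mem i) (Mem j) = list_encode (fst (run M B alg (input a) (Suc i)))"
| "msg a (Mem i) (Ver v) = list_encode (contents M B alg (input a) K v)"
| "msg a (Ver v) u = list_encode (contents M B alg (input a) K v)"
| "msg a u v = 0"

definition gather :: "(node \<times> node \<Rightarrow> nat) \<Rightarrow> nat \<Rightarrow> nat" where
  "gather y = (\<lambda>p\<in>{..<N}. list_decode (y (Src (p div B), Hub)) ! (p mod B))"

definition mem_before :: "nat \<Rightarrow> (node \<times> node \<Rightarrow> nat) \<Rightarrow> memory" where
  "mem_before i y = (case i of 0 \<Rightarrow> replicate M 0 | Suc j \<Rightarrow> list_decode (y (Mem j, Mem i)))"

definition received_block :: "nat option \<Rightarrow> node \<Rightarrow> (node \<times> node \<Rightarrow> nat) \<Rightarrow> nat list" where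
  "received_block ver u y = (case ver of None \<Rightarrow> replicate B 0 | Some v \<Rightarrow> list_decode (y (Ver v, u)))"

text \<open>A disk that shows the received block at every address replaces the true disk, as a step
  sees one block only.\<close>

definition simulate :: "nat \<Rightarrow> (node \<times> node \<Rightarrow> nat) \<Rightarrow> memory \<times> disk" where
  "simulate i y = perform B (alg i (mem_before i y)) (\<lambda>_. received_block (pv i) (Mem i) y)"

fun send :: "node \<Rightarrow> node \<Rightarrow> (node \<times> node \<Rightarrow> nat) \<Rightarrow> (nat \<Rightarrow> nat) \<Rightarrow> nat" where
  "send (Src k) v y m = list_encode (map (\<lambda>l. m (k * B + l)) [0..<B])"
| "send Hub (Ver k) y m = encode_bits (correction_in k (gather y))"
| "send Hub (Out k) y m = encode_bits (correction_out k (gather y))"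
| "send (Mem i) (Mem j) y m = list_encode (fst (simulate i y))"
| "send (Mem i) (Ver v) y m =
     list_encode (snd (simulate i y) (address (snd (alg i (mem_before i y)))))"
| "send (Ver v) u y m = (if v < K
     then list_encode (map (\<lambda>l. flip_bits (list_decode (y (Src v, Ver v)) ! l)
       {b. (v * B + l, b) \<in> decode_bits (y (Hub, Ver v))}) [0..<B])
     else y (Mem (v - K), Ver v))"
| "send u v y m = 0"

text \<open>The reduction modulo \<open>2 ^ w\<close> keeps the result in the message set for
  arbitrary received symbols, as the typing of decoders demands.\<close>

definition recover :: "nat \<Rightarrow> (node \<times> node \<Rightarrow> nat) \<Rightarrow> nat" where
  "recover p y = flip_bits (received_block (fv (\<sigma> p div B)) (Out (\<sigma> p div B)) y ! (\<sigma> p mod B))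
     {b. (p, b) \<in> decode_bits (y (Hub, Out (\<sigma> p div B)))} mod 2 ^ w"

text \<open>Alphabets are unrestricted; entropy alone limits what an edge carries.\<close>

definition solution :: "nat coding_solution" where
  "solution = \<lparr>messages = (\<lambda>_. {..<2 ^ w}), alphabet = (\<lambda>_. UNIV),
     edge_fun = (\<lambda>e x. send (from_nat (fst e)) (from_nat (snd e)) (\<lambda>(u, v). x (nd u, nd v))),
     decoder = (\<lambda>p x m. recover p (\<lambda>(u, v). x (nd u, nd v)))\<rparr>"

section \<open>Correctness of the coding solution\<close>

lemma inputs_eq: "inputs network solution = words N w"
  by (simp add: inputs_def solution_def words_def)

lemma well_typed: "well_typed_solution network solution"
  by (auto simp: well_typed_solution_def received_funs_def solution_def recover_def lessThan_empty_iff)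

lemma
  assumes "a \<in> words N w"
  shows finite_correction: "finite (correction a)"
    and correction_subset: "correction a \<subseteq> {..<N} \<times> {..<w}"
proof -
  have "a p < 2 ^ w" "near a p < 2 ^ w" if "p < N" for p
    using that assms near[OF assms] \<Gamma> by (auto simp: words_def)
  then show sub: "correction a \<subseteq> {..<N} \<times> {..<w}"
    unfolding correction_def by (auto dest!: set_decode_subset)
  then show "finite (correction a)" by (rule finite_subset) simp
qed

lemma flip_to_near: "p < N \<Longrightarrow> flip_bits (a p) {b. (p, b) \<in> correction a} = near a p"
proof -
  assume "p < N"
  then have "sym_diff (set_decode (a p)) {b. (p, b) \<in> correction a} = set_decode (near a p)"
    by (auto simp: correction_def)
  then show ?thesis by (simp add: flip_bits_def)
qed

lemma flip_from_near: "p < N \<Longrightarrow> flip_bits (near a p) {b. (p, b) \<in> correction a} = a p"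
proof -
  assume "p < N"
  then have "sym_diff (set_decode (near a p)) {b. (p, b) \<in> correction a} = set_decode (a p)"
    by (auto simp: correction_def)
  then show ?thesis by (simp add: flip_bits_def)
qed

lemma block_index: "k < K \<Longrightarrow> l < B \<Longrightarrow> k * B + l < N \<and> (k * B + l) div B = k"
proof -
  assume k: "k < K" and l: "l < B"
  have "Suc k * B \<le> K * B" using k by (intro mult_le_mono1) simp
  then show ?thesis using l by (simp add: N)
qed

lemma gather_eq:
  assumes a: "a \<in> words N w" and y: "\<And>k. k < K \<Longrightarrow> y (Src k, Hub) = msg a (Src k) Hub"
  shows "gather y = a"
proof
  fix p show "gather y p = a p"
  proof (cases "p < N")
    case True
    then show ?thesis using y[OF div_less_K[OF True]] B_pos by (simp add: gather_def)
  next
    case False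
    then show ?thesis using a by (simp add: gather_def words_def PiE_iff extensional_def)
  qed
qed

lemma received_block_eq:
  assumes a: "a \<in> words N w"
    and ver: "version K (access M B alg (input a)) t d = ver"
    and y: "\<And>v. ver = Some v \<Longrightarrow> y (Ver v, u) = list_encode (contents M B alg (input a) K v)"
  shows "received_block ver u y = snd (run M B alg (input a) t) d"
proof -
  have "flat_disk B K (near a) d = replicate B 0" if "d \<ge> K" for d
    using that by (simp add: flat_disk_def)
  from disk_eq_contents[where K = K and D = "input a" and M = M and B = B and alg = alg and t = t and d = d, OF this]
  show ?thesis
    using y by (auto simp: received_block_def ver split: option.split)
qed

text \<open>Since \<open>near a\<close> lies in \<Gamma>, the version accessed in step
  \<open>i\<close> is the one wired to \<open>Mem i\<close>. With the memory from the previous step,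
  this is all that the step depends on.\<close>

lemma simulate_eq:
  assumes a: "a \<in> words N w" and i: "i < T" and y: "\<And>u. link u (Mem i) \<Longrightarrow> y (u, Mem i) = msg a u (Mem i)"
  shows "mem_before i y = fst (run M B alg (input a) i)"
    and "fst (simulate i y) = fst (run M B alg (input a) (Suc i))"
    and "snd (simulate i y) (access M B alg (input a) i) = contents M B alg (input a) K (K + i)"
proof -
  let ?D = "input a"
  show mem: "mem_before i y = fst (run M B alg ?D i)"
  proof (cases i)
    case (Suc j)
    then show ?thesis using y[of "Mem j"] i by (simp add: mem_before_def del: run.simps(2))
  qed (simp add: mem_before_def)
  have "received_block (pv i) (Mem i) y = snd (run M B alg ?D i) (access M B alg ?D i)"
    using y i by (intro received_block_eq a reads[OF near[OF a] i]) auto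
  then have *: "(\<lambda>_. received_block (pv i) (Mem i) y) (address (snd (alg i (mem_before i y))))
      = snd (run M B alg ?D i) (address (snd (alg i (mem_before i y))))"
    by (simp add: access_def mem)
  note cong = perform_cong[where D = "\<lambda>_. received_block (pv i) (Mem i) y" and D' = "snd (run M B alg ?D i)"
      and x = "alg i (mem_before i y)", OF *]
  show "fst (simulate i y) = fst (run M B alg ?D (Suc i))"
    using cong(1)[of B] unfolding simulate_def run_Suc mem .
  show "snd (simulate i y) (access M B alg ?D i) = contents M B alg ?D K (K + i)"
    using cong(2)[of B] unfolding simulate_def contents_def run_Suc mem access_def by simp
qed

lemma send_eq_msg:
  assumes a: "a \<in> words N w" and uv: "link u v"
    and y: "\<And>u'. link u' u \<Longrightarrow> y (u', u) = msg a u' u"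
    and m: "\<And>k p. u = Src k \<Longrightarrow> p < N \<Longrightarrow> p div B = k \<Longrightarrow> m p = a p"
  shows "send u v y m = msg a u v"
proof (cases u)
  case Hub
  then have "gather y = a" using y by (intro gather_eq a) auto
  then show ?thesis using Hub uv by (cases v) auto
next
  case (Src k)
  then have "k < K" using uv by (cases v) auto
  then have "map (\<lambda>l. m (k * B + l)) [0..<B] = map (\<lambda>l. a (k * B + l)) [0..<B]"
    using m[OF Src] block_index by auto
  then show ?thesis unfolding Src by (simp only: send.simps msg.simps)
next
  case (Mem i)
  then have i: "i < T" using uv by (cases v) auto
  note sim = simulate_eq[OF a i y[unfolded Mem]]
  show ?thesis
  proof (cases v)
    case (Ver x)
    then have "x = K + i" using uv Mem by simp
    then show ?thesis using sim(1,3) unfolding Mem Ver send.simps msg.simps access_def by simp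
  next
    case (Mem j)
    then show ?thesis using sim(2) unfolding \<open>u = Mem i\<close> Mem send.simps msg.simps by simp
  qed (use uv Mem in auto)
next
  case (Ver x)
  show ?thesis
  proof (cases "x < K")
    case True
    have "y (Src x, Ver x) = msg a (Src x) (Ver x)" "y (Hub, Ver x) = msg a Hub (Ver x)"
      using y Ver True by auto
    moreover have "finite (correction_in x a)"
      using finite_correction[OF a] by (rule finite_subset[rotated]) (auto simp: correction_in_def)
    moreover have "flip_bits (a (x * B + l)) {b. (x * B + l, b) \<in> correction_in x a} = near a (x * B + l)"
      if "l < B" for l
      using flip_to_near[of "x * B + l" a] block_index[OF True that] by (simp add: correction_in_def)
    ultimately have *: "map (\<lambda>l. flip_bits (list_decode (y (Src x, Ver x)) ! l)
        {b. (x * B + l, b) \<in> decode_bits (y (Hub, Ver x))}) [0..<B] = map (\<lambda>l. near a (x * B + l)) [0..<B]"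
      by (simp add: decode_encode_bits)
    show ?thesis
      unfolding Ver send.simps msg.simps contents_def flat_disk_def if_P[OF True] * ..
  next
    case False
    have "x < K + T" using uv Ver pv_less fv_less by (cases v) fastforce+
    then have "y (Mem (x - K), Ver x) = msg a (Mem (x - K)) (Ver x)"
      using y[of "Mem (x - K)"] False unfolding Ver by simp
    then show ?thesis using False Ver by simp
  qed
next
  case (Out k)
  then show ?thesis using uv by simp
qed

text \<open>The intended messages satisfy all local equations, which have a unique solution on an
  acyclic network.\<close>

lemma sent_eq:
  assumes a: "a \<in> words N w" and uv: "link u v"
  shows "sent network solution a (nd u, nd v) = msg a u v"
proof -
  define x where "x = restrict (\<lambda>(s, t). msg a (from_nat s) (from_nat t)) (edges network)"
  have "transmission network solution a x"
    unfolding transmission_def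
  proof (intro conjI ballI)
    show "x \<in> extensional (edges network)" by (simp add: x_def)
    fix e assume "e \<in> edges network"
    then obtain u v where e: "e = (nd u, nd v)" and uv: "link u v" by (auto simp: edges_network)
    have "send u v (\<lambda>(u', v'). restrict x (in_edges network (nd u)) (nd u', nd v'))
        (restrict a (sources_at network (nd u))) = msg a u v"
    proof (rule send_eq_msg[OF a uv])
      show "(case (u', u) of (u', v') \<Rightarrow> restrict x (in_edges network (nd u)) (nd u', nd v')) = msg a u' u"
        if "link u' u" for u'
        using that by (simp add: x_def in_edges_def)
      show "restrict a (sources_at network (nd u)) p = a p" if "u = Src k" "p < N" "p div B = k" for k p
        using that by (simp add: sources_at_def)
    qed
    then show "x e = edge_fun solution e (restrict x (in_edges network (fst e)))
        (restrict a (sources_at network (fst e)))"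
      using uv by (simp add: solution_def e x_def)
  qed
  then have "sent network solution a = x"
    unfolding sent_def by (rule the1_equality[OF ex1_transmission[OF k_pairs_instance_network]])
  then show ?thesis using uv by (simp add: x_def)
qed

lemma decodes: "decodes network solution"
  unfolding decodes_def inputs_eq
proof (intro ballI allI impI)
  fix a p assume a: "a \<in> words N w" and "p < npairs network"
  then have p: "p < N" by simp
  define k where "k = \<sigma> p div B"
  have k: "k < K" using \<sigma>_less[OF p] by (simp add: k_def div_less_K)
  let ?x = "restrict (sent network solution a) (in_edges network (sink network p))"
  define y where "y = (\<lambda>(u, v). ?x (nd u, nd v))"
  have y: "y (u, Out k) = msg a u (Out k)" if "link u (Out k)" for u
    using that by (simp add: y_def in_edges_def k_def sent_eq[OF a])
  have "received_block (fv k) (Out k) y = snd (run M B alg (input a) T) (out + k)"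
    using y k by (intro received_block_eq a writes[OF near[OF a] k]) auto
  also have "\<dots> = map (\<lambda>l. near a (\<sigma> (k * B + l))) [0..<B]"
    by (rule transposed[OF near[OF a] k])
  finally have "received_block (fv k) (Out k) y ! (\<sigma> p mod B) = near a (\<sigma> (k * B + \<sigma> p mod B))"
    using B_pos by simp
  \<comment> \<open>As \<sigma> is an involution, output position \<open>\<sigma> p\<close> holds
    entry \<open>p\<close>.\<close>
  also have "\<dots> = near a p"
    using \<sigma>_\<sigma>[OF p] by (simp add: k_def)
  finally have blk: "received_block (fv k) (Out k) y ! (\<sigma> p mod B) = near a p" .
  have "finite (correction_out k a)"
    using finite_correction[OF a] by (rule finite_subset[rotated]) (auto simp: correction_out_def)
  moreover have "y (Hub, Out k) = encode_bits (correction_out k a)"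
    using y[of Hub] k by simp
  ultimately have "decode_bits (y (Hub, Out k)) = correction_out k a"
    by (simp add: decode_encode_bits)
  then have bits: "{b. (p, b) \<in> decode_bits (y (Hub, Out k))} = {b. (p, b) \<in> correction a}"
    by (simp add: correction_out_def k_def)
  have "recover p y = flip_bits (near a p) {b. (p, b) \<in> correction a} mod 2 ^ w"
    unfolding recover_def k_def[symmetric] blk bits ..
  also have "\<dots> = a p mod 2 ^ w"
    by (simp only: flip_from_near[OF p])
  also have "\<dots> = a p"
    using PiE_mem[OF a[unfolded words_def], of p] p by simp
  finally show "decoder solution p ?x (restrict a (sources_at network (sink network p))) = a p"
    by (simp add: solution_def y_def)
qed

end

subsection \<open>Capacities and the flow bound\<close>

context coding_network
begin

section \<open>Entropy of the edge messages\<close>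

lemma flat_disk_word_lists:
  assumes "a \<in> words N w"
  shows "flat_disk B K a d \<in> word_lists w B"
proof (cases "d < K")
  case True
  have "a (d * B + l) < 2 ^ w" if "l < B" for l
    using PiE_mem[OF assms[unfolded words_def], of "d * B + l"] block_index[OF True that] by simp
  then show ?thesis using True by (auto simp: flat_disk_def word_lists_def)
next
  case False
  then show ?thesis by (simp add: flat_disk_def word_lists_def set_replicate_conv_if)
qed

lemma near_words: "a \<in> words N w \<Longrightarrow> near a \<in> words N w"
  using near \<Gamma> by blast

lemma contents_word_lists:
  assumes "a \<in> words N w"
  shows "contents M B alg (input a) K v \<in> word_lists w B"
  using run_word_lists[where D = "input a", OF valid flat_disk_word_lists[OF near_words[OF assms]]]
    flat_disk_word_lists[OF near_words[OF assms]] by (simp add: contents_def del: run.simps)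

lemma entropy_words:
  assumes uv: "link u v" and msg: "\<And>a. a \<in> words N w \<Longrightarrow> \<exists>xs\<in>word_lists w k. msg a u v = list_encode xs"
  shows "msg_entropy network solution (\<lambda>a. sent network solution a (nd u, nd v)) \<le> k * w"
proof (rule msg_entropy_le_log_card)
  show "finite (inputs network solution)" "inputs network solution \<noteq> {}"
    by (simp_all add: inputs_eq finite_words words_nonempty)
  show "(\<lambda>a. sent network solution a (nd u, nd v)) ` inputs network solution \<subseteq> list_encode ` word_lists w k"
    unfolding inputs_eq using msg sent_eq[OF _ uv] by fastforce
  show "finite (list_encode ` word_lists w k)" by (simp add: finite_word_lists)
  have "card (list_encode ` word_lists w k) \<le> 2 ^ (w * k)"
    using card_image_le[OF finite_word_lists, of list_encode w k] by (simp add: card_word_lists)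
  then have "real (card (list_encode ` word_lists w k)) \<le> 2 ^ (w * k)"
    by (metis of_nat_le_iff of_nat_numeral of_nat_power)
  also have "(2::real) ^ (w * k) = 2 powr real (k * w)"
    by (subst powr_realpow) (auto simp: mult.commute)
  finally show "real (card (list_encode ` word_lists w k)) \<le> 2 powr real (k * w)" .
qed

text \<open>Counting possible values would cost about \<open>B * w\<close> bits. The weighted code
  for sets of flipped bits is much shorter when few bits are flipped on average.\<close>

lemma entropy_bits:
  assumes uv: "link u v" and P: "P \<subseteq> {..<N}" "card P = B"
    and msg: "\<And>a. msg a u v = encode_bits {(p, b) \<in> correction a. p \<in> P}"
  shows "msg_entropy network solution (\<lambda>a. sent network solution a (nd u, nd v))
    \<le> 6 * mean (\<lambda>a. card {(p, b) \<in> correction a. p \<in> P}) + B * w / 40"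
proof -
  let ?X = "\<lambda>a. sent network solution a (nd u, nd v)" and ?c = "\<lambda>a. {(p, b) \<in> correction a. p \<in> P}"
  let ?W = "words N w"
  define J where "J = P \<times> {..<w}"
  define g where "g y = 6 * real (card (decode_bits y)) + card J / 40" for y
  have fin: "finite J" using P by (auto simp: J_def intro: finite_subset)
  have cardJ: "card J = B * w" by (simp add: J_def card_cartesian_product P)
  have sub: "?c a \<subseteq> J" if "a \<in> ?W" for a
    using correction_subset[OF that] by (auto simp: J_def)
  have X: "?X a = encode_bits (?c a)" if "a \<in> ?W" for a
    using sent_eq[OF that uv] msg by simp
  have dec: "decode_bits (encode_bits Z) = Z" if "Z \<in> Pow J" for Z
    using that fin by (intro decode_encode_bits) (auto intro: finite_subset)
  have ne: "finite (inputs network solution)" "inputs network solution \<noteq> {}"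
    by (simp_all add: inputs_eq finite_words words_nonempty)
  have inj: "inj_on encode_bits (Pow J)" using dec by (rule inj_on_inverseI)
  have "(\<Sum>y\<in>?X ` ?W. 2 powr (- g y)) \<le> (\<Sum>y\<in>encode_bits ` Pow J. 2 powr (- g y))"
    using X sub fin by (intro sum_mono2) auto
  also have "\<dots> = (\<Sum>Z\<in>Pow J. 2 powr (- (6 * real (card Z) + card J / 40)))"
    unfolding sum.reindex[OF inj] using dec by (intro sum.cong) (auto simp: g_def)
  also have "\<dots> \<le> 1" by (rule kraft_weighted_subsets[OF fin])
  finally have "msg_entropy network solution ?X \<le> (\<Sum>a\<in>?W. g (?X a)) / card ?W"
    using msg_entropy_le_mean_cost[where g = g, OF ne] unfolding inputs_eq by blast
  also have "(\<Sum>a\<in>?W. g (?X a)) = (\<Sum>a\<in>?W. 6 * real (card (?c a)) + B * w / 40)"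
    using X dec sub by (intro sum.cong refl) (simp add: g_def cardJ)
  also have "\<dots> / card ?W = 6 * mean (\<lambda>a. card (?c a)) + B * w / 40"
    using finite_words[of N w] words_nonempty[of N w]
    by (simp add: mean_def sum.distrib add_divide_distrib sum_distrib_left)
  finally show ?thesis .
qed

lemma card_block: "k < K \<Longrightarrow> card {p. p < N \<and> p div B = k} = B"
proof -
  assume k: "k < K"
  have "{p. p < N \<and> p div B = k} = {k * B..<k * B + B}"
  proof (intro equalityI subsetI)
    fix p assume "p \<in> {k * B..<k * B + B}"
    then show "p \<in> {p. p < N \<and> p div B = k}" using block_index[OF k, of "p - k * B"] by auto
  next
    fix p assume "p \<in> {p. p < N \<and> p div B = k}"
    then have "p = k * B + p mod B" "p mod B < B" using B_pos by auto
    then show "p \<in> {k * B..<k * B + B}" by (metis add_less_cancel_left atLeastLessThan_iff le_add1)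
  qed
  then show ?thesis by simp
qed

lemma card_output_block: "k < K \<Longrightarrow> card {p. p < N \<and> \<sigma> p div B = k} = B"
proof -
  assume k: "k < K"
  have "bij_betw \<sigma> {p. p < N \<and> \<sigma> p div B = k} {p. p < N \<and> p div B = k}"
    by (rule bij_betw_byWitness[where f' = \<sigma>]) (auto simp: \<sigma>_\<sigma> \<sigma>_less)
  then show ?thesis using card_block[OF k] by (simp add: bij_betw_same_card)
qed

lemma entropy_link:
  assumes uv: "link u v"
  shows "msg_entropy network solution (\<lambda>a. sent network solution a (nd u, nd v)) \<le> node_cap u v"
proof (cases u)
  case Hub
  have c: "msg_entropy network solution (\<lambda>a. sent network solution a (nd u, nd v)) \<le> node_cap u v"
    if v: "v = Ver k" for k
  proof -
    have k: "k < K" using uv Hub v by simp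
    have eq: "correction_in k a = {(p, b) \<in> correction a. p \<in> {p. p < N \<and> p div B = k}}" for a
      by (auto simp: correction_in_def correction_def)
    show ?thesis
      using entropy_bits[OF uv, of "{p. p < N \<and> p div B = k}"] card_block[OF k] eq
      unfolding Hub v by auto
  qed
  have d: "msg_entropy network solution (\<lambda>a. sent network solution a (nd u, nd v)) \<le> node_cap u v"
    if v: "v = Out k" for k
  proof -
    have k: "k < K" using uv Hub v by simp
    have eq: "correction_out k a = {(p, b) \<in> correction a. p \<in> {p. p < N \<and> \<sigma> p div B = k}}" for a
      by (auto simp: correction_out_def correction_def)
    show ?thesis
      using entropy_bits[OF uv, of "{p. p < N \<and> \<sigma> p div B = k}"] card_output_block[OF k] eq
      unfolding Hub v by auto
  qed
  from c d uv Hub show ?thesis by (cases v) auto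
next
  case (Src k)
  then have k: "k < K" using uv by (cases v) auto
  have "msg_entropy network solution (\<lambda>a. sent network solution a (nd u, nd v)) \<le> B * w"
  proof (rule entropy_words[OF uv])
    fix a assume "a \<in> words N w"
    from flat_disk_word_lists[OF this, of k] show "\<exists>xs\<in>word_lists w B. msg a u v = list_encode xs"
      using k Src by (auto simp: flat_disk_def)
  qed
  then show ?thesis using Src by simp
next
  case (Ver x)
  have "msg_entropy network solution (\<lambda>a. sent network solution a (nd u, nd v)) \<le> B * w"
    using contents_word_lists by (intro entropy_words[OF uv]) (auto simp: Ver)
  then show ?thesis using Ver by simp
next
  case (Mem i)
  show ?thesis
  proof (cases v)
    case (Mem j)
    have "msg_entropy network solution (\<lambda>a. sent network solution a (nd u, nd v)) \<le> M * w"
    proof (rule entropy_words[OF uv])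
      fix a assume "a \<in> words N w"
      from run_word_lists[where D = "input a" and t = "Suc i", OF valid flat_disk_word_lists[OF near_words[OF this]]]
      show "\<exists>xs\<in>word_lists w M. msg a u v = list_encode xs"
        unfolding \<open>u = Mem i\<close> Mem msg.simps by blast
    qed
    then show ?thesis using Mem \<open>u = Mem i\<close> by simp
  next
    case (Ver x)
    have "msg_entropy network solution (\<lambda>a. sent network solution a (nd u, nd v)) \<le> B * w"
      using contents_word_lists by (intro entropy_words[OF uv]) (auto simp: Mem Ver)
    then show ?thesis using Ver Mem by simp
  qed (use uv Mem in auto)
next
  case (Out k)
  then show ?thesis using uv by simp
qed

lemma coding_achieves_network: "coding_achieves network (real w)"
  unfolding coding_achieves_def
proof (intro exI[of _ solution] conjI allI impI ballI well_typed decodes)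
  fix i assume "i < npairs network"
  then show "real w \<le> msg_entropy network solution (\<lambda>a. a i)"
    by (intro eq_refl msg_entropy_source[symmetric]) (auto simp: solution_def)
next
  fix e assume "e \<in> edges network"
  then show "msg_entropy network solution (\<lambda>a. sent network solution a e) \<le> cap network e"
    using entropy_link by (auto simp: edges_network)
qed

section \<open>Edge lengths and potentials\<close>

fun len :: "nat \<Rightarrow> node \<Rightarrow> node \<Rightarrow> real" where
  "len L (Src k) Hub = L / 2"
| "len L Hub v = L / 2"
| "len L (Mem i) (Mem j) = (if q dvd j then 1 else 0)"
| "len L (Ver v) (Mem j) = 1"
| "len L u v = 0"

text \<open>The hub lies half way between everything, so that a route through it is as long as \<open>L\<close>.\<close>

fun potential :: "nat \<Rightarrow> nat \<Rightarrow> node \<Rightarrow> real" where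
  "potential L s Hub = L / 2"
| "potential L s (Src k) = capped_dist L (Inl s) (Inl k)"
| "potential L s (Ver v) = capped_dist L (Inl s) (version_cluster v)"
| "potential L s (Mem i) = capped_dist L (Inl s) (Inr (i div q))"
| "potential L s (Out k) =
     (case fv k of None \<Rightarrow> L | Some v \<Rightarrow> capped_dist L (Inl s) (version_cluster v))"

text \<open>An output block without a version counts as far: only the hub links to it, and its
  potential is \<open>L\<close>.\<close>

definition near_pairs :: "nat \<Rightarrow> nat set" where
  "near_pairs L = {p. p < N \<and> (\<exists>v. fv (\<sigma> p div B) = Some v \<and>
     version_cluster v \<in> ball (Inl (p div B)) (L - 1))}"

lemma potential_range: "0 \<le> potential L s u" "potential L s u \<le> L"
  using capped_dist_le[of L "Inl s"] by (cases u; auto split: option.split)+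

text \<open>Links of length \<open>0\<close> stay inside a cluster, links of length \<open>1\<close>
  join neighbouring clusters, and a hub link suffices for any jump from \<open>L / 2\<close> to a
  value between \<open>0\<close> and \<open>L\<close>.\<close>

lemma potential_lipschitz:
  assumes "link u v"
  shows "\<bar>potential L s v - potential L s u\<bar> \<le> len L u v"
proof -
  have hub: "\<bar>potential L s x - L / 2\<bar> \<le> L / 2" for x
    using potential_range[of L s x] by linarith
  \<comment> \<open>A new phase starts at step \<open>Suc i\<close> exactly if
    \<open>q dvd Suc i\<close>; otherwise both memory nodes are in one cluster.\<close>
  have chain: "\<bar>potential L s (Mem (Suc i)) - potential L s (Mem i)\<bar> \<le> len L (Mem i) (Mem (Suc i))" for i
    using capped_dist_lipschitz[OF neighbours_next, of L "Inl s" "i div q"]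
    by (auto simp: div_Suc dvd_eq_mod_eq_0)
  show ?thesis
    using assms hub chain
  proof (induction u v rule: link.induct)
    case (1 k)
    then show ?case using hub[of "Src k"] by (simp add: abs_minus_commute)
  next
    case (3 v)
    then show ?case using hub[of "Ver v"] by simp
  next
    case (4 k)
    then show ?case using hub[of "Out k"] by (simp del: potential.simps(5))
  next
    case (5 i j)
    then show ?case using chain[of i] by simp
  next
    case (7 v j)
    then show ?case using capped_dist_lipschitz[OF neighbours_read, of j v L "Inl s"] by simp
  qed (auto simp: version_cluster_def)
qed

lemma card_multiples: "card {j. 0 < j \<and> j < T \<and> q dvd j} * q \<le> T"
proof -
  have "{j. 0 < j \<and> j < T \<and> q dvd j} \<subseteq> (\<lambda>m. q * m) ` {1..T div q}"
  proof
    fix j assume "j \<in> {j. 0 < j \<and> j < T \<and> q dvd j}"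
    then obtain m where m: "j = q * m" "0 < q * m" "q * m < T" by auto
    then have "m \<le> T div q" using q_pos by (simp add: less_eq_div_iff_mult_less_eq mult.commute)
    then show "j \<in> (\<lambda>m. q * m) ` {1..T div q}" using m by auto
  qed
  then have "card {j. 0 < j \<and> j < T \<and> q dvd j} \<le> card ((\<lambda>m. q * m) ` {1..T div q})"
    by (intro card_mono) auto
  also have "\<dots> \<le> T div q" using card_image_le[of "{1..T div q}" "\<lambda>m. q * m"] by simp
  finally have "card {j. 0 < j \<and> j < T \<and> q dvd j} * q \<le> T div q * q" by (rule mult_le_mono1)
  then show ?thesis by (rule order_trans) simp
qed

lemma mean_add: "mean f + mean g = mean (\<lambda>a. f a + g a)"
  by (simp add: mean_def sum.distrib add_divide_distrib)

lemma sum_mean: "finite I \<Longrightarrow> (\<Sum>k\<in>I. mean (f k)) = mean (\<lambda>a. \<Sum>k\<in>I. f k a)"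
  by (induction I rule: finite_induct) (auto simp: mean_add, simp add: mean_def)

text \<open>Every flipped bit belongs to exactly one block, so the corrections sent to all blocks
  together cost what the whole correction costs.\<close>

lemma mean_partition:
  assumes h: "\<And>p. p < N \<Longrightarrow> h p < K"
  shows "(\<Sum>k<K. mean (\<lambda>a. card {(p, b) \<in> correction a. h p = k})) = mean (\<lambda>a. card (correction a))"
proof -
  have "(\<Sum>k<K. card {(p, b) \<in> correction a. h p = k}) = card (correction a)" if "a \<in> words N w" for a
  proof -
    have "correction a = (\<Union>k<K. {(p, b) \<in> correction a. h p = k})"
      using correction_subset[OF that] h by blast
    moreover have "card (\<Union>k<K. {(p, b) \<in> correction a. h p = k})
        = (\<Sum>k<K. card {(p, b) \<in> correction a. h p = k})"
      using finite_correction[OF that]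
      by (intro card_UN_disjoint) (auto intro: finite_subset[rotated])
    ultimately show ?thesis by simp
  qed
  then have "mean (\<lambda>a. \<Sum>k<K. card {(p, b) \<in> correction a. h p = k}) = mean (\<lambda>a. card (correction a))"
    unfolding mean_def by (intro arg_cong2[of _ _ _ _ "(/)"] sum.cong) auto
  then show ?thesis by (simp add: sum_mean)
qed

text \<open>The sources send \<open>N * w\<close> bits into the hub, and each of the two families of
  corrections adds \<open>N * w / 40\<close> and six times the mean number of flips. Phase
  boundaries contribute at most \<open>2 * T * B * w\<close> and block transfers
  \<open>T * B * w\<close>.\<close>

lemma sum_len_cap:
  assumes q: "q = M div B"
  shows "(\<Sum>(u, v)\<in>{(u, v). link u v}. len L u v * node_cap u v)
    \<le> L / 2 * (21 / 20 * N * w + 12 * mean (\<lambda>a. card (correction a))) + 3 * T * B * w"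
proof -
  define h where "h = (\<lambda>(u, v). len L u v * node_cap u v)"
  have len0: "len L u v \<ge> 0" for u v by (induction L u v rule: len.induct) auto
  have h0: "h x \<ge> 0" for x
    by (cases x) (simp add: h_def len0 less_imp_le[OF node_cap_pos])
  define A where "A = (\<lambda>k. (Src k, Hub)) ` {..<K}"
  define C where "C = (\<lambda>k. (Hub, Ver k)) ` {..<K}"
  define D where "D = (\<lambda>k. (Hub, Out k)) ` {..<K}"
  define E where "E = (\<lambda>j. (Mem (j - 1), Mem j)) ` {j. 0 < j \<and> j < T \<and> q dvd j}"
  define F where "F = (\<lambda>j. (Ver (the (pv j)), Mem j)) ` {..<T}"
  have image: "sum h (f ` I) \<le> (\<Sum>i\<in>I. h (f i))" if "finite I" for f :: "nat \<Rightarrow> node \<times> node" and I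
    using sum_image_le[OF that, of h f] h0 by (simp add: o_def)
  have NKB: "real N = real K * real B" by (simp add: N)
  note defs = A_def C_def D_def E_def F_def
  have fin: "finite A" "finite C" "finite D" "finite E" "finite F" by (auto simp: defs)
  \<comment> \<open>The links of nonzero length enter or leave the hub (\<open>A\<close>,
    \<open>C\<close>, \<open>D\<close>), cross a phase boundary (\<open>E\<close>) or deliver an
    accessed block (\<open>F\<close>).\<close>
  have "h x = 0 \<or> x \<in> A \<union> (C \<union> (D \<union> (E \<union> F)))" if "x \<in> {(u, v). link u v}" for x
  proof -
    obtain u v where x: "x = (u, v)" by fastforce
    then have "link u v" using that by simp
    then have "len L u v = 0 \<or> (u, v) \<in> A \<union> (C \<union> (D \<union> (E \<union> F)))"
      by (induction u v rule: link.induct) (auto simp: defs image_iff)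
    then show ?thesis by (auto simp: x h_def)
  qed
  then have "sum h {(u, v). link u v} = sum h {x \<in> {(u, v). link u v}. x \<in> A \<union> (C \<union> (D \<union> (E \<union> F)))}"
    using finite_links by (intro sum.mono_neutral_right) auto
  also have "\<dots> \<le> sum h (A \<union> (C \<union> (D \<union> (E \<union> F))))"
    using fin h0 by (intro sum_mono2) auto
  also have "\<dots> \<le> sum h A + (sum h C + (sum h D + (sum h E + sum h F)))"
    using fin h0 by (intro order_trans[OF sum_union_le] add_left_mono) auto
  also have "sum h A \<le> (\<Sum>k<K. h (Src k, Hub))"
    unfolding A_def by (rule image) simp
  also have "sum h C \<le> (\<Sum>k<K. h (Hub, Ver k))"
    unfolding C_def by (rule image) simp
  also have "sum h D \<le> (\<Sum>k<K. h (Hub, Out k))"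
    unfolding D_def by (rule image) simp
  also have "sum h E \<le> (\<Sum>j\<in>{j. 0 < j \<and> j < T \<and> q dvd j}. h (Mem (j - 1), Mem j))"
    unfolding E_def by (rule image) simp
  also have "sum h F \<le> (\<Sum>j<T. h (Ver (the (pv j)), Mem j))"
    unfolding F_def by (rule image) simp
  also have "(\<Sum>k<K. h (Src k, Hub)) = L / 2 * (N * w)"
    by (simp add: h_def NKB)
  also have "(\<Sum>k<K. h (Hub, Ver k)) = L / 2 * (6 * mean (\<lambda>a. card (correction a)) + N * w / 40)"
  proof -
    have "(\<Sum>k<K. h (Hub, Ver k)) = (\<Sum>k<K. L / 2 * (6 * mean (\<lambda>a. card (correction_in k a)) + B * w / 40))"
      by (simp add: h_def)
    also have "\<dots> = L / 2 * (6 * (\<Sum>k<K. mean (\<lambda>a. card (correction_in k a))) + K * (B * w / 40))"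
      unfolding sum_distrib_left[symmetric] sum.distrib by simp
    finally show ?thesis using mean_partition[of "\<lambda>p. p div B"] div_less_K
      by (simp add: correction_in_def NKB)
  qed
  also have "(\<Sum>k<K. h (Hub, Out k)) = L / 2 * (6 * mean (\<lambda>a. card (correction a)) + N * w / 40)"
  proof -
    have "(\<Sum>k<K. h (Hub, Out k)) = (\<Sum>k<K. L / 2 * (6 * mean (\<lambda>a. card (correction_out k a)) + B * w / 40))"
      by (simp add: h_def)
    also have "\<dots> = L / 2 * (6 * (\<Sum>k<K. mean (\<lambda>a. card (correction_out k a))) + K * (B * w / 40))"
      unfolding sum_distrib_left[symmetric] sum.distrib by simp
    finally show ?thesis using mean_partition[of "\<lambda>p. \<sigma> p div B"] div_less_K \<sigma>_less
      by (simp add: correction_out_def NKB)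
  qed
  also have "(\<Sum>j\<in>{j. 0 < j \<and> j < T \<and> q dvd j}. h (Mem (j - 1), Mem j)) \<le> 2 * T * B * w"
  proof -
    let ?c = "card {j. 0 < j \<and> j < T \<and> q dvd j}"
    \<comment> \<open>Rounding \<open>M / B\<close> down to \<open>q\<close> costs at most a factor
      \<open>2\<close>, because \<open>q \<ge> 1\<close>.\<close>
    have "M = B * q + M mod B" by (simp add: q)
    also have "M mod B \<le> B * q" using B_pos q_pos by (metis less_imp_le mod_less_divisor mult_le_mono2
      mult.right_neutral order_trans One_nat_def Suc_le_lessD)
    finally have "?c * M \<le> ?c * (2 * (B * q))" by simp
    also have "\<dots> = ?c * q * (2 * B)" by simp
    also have "\<dots> \<le> T * (2 * B)" by (rule mult_le_mono1[OF card_multiples])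
    finally have "real (?c * M) \<le> real (T * (2 * B))" by (rule of_nat_mono)
    then have "real (?c * M) * w \<le> real (T * (2 * B)) * w" by (rule mult_right_mono) simp
    moreover have "(\<Sum>j\<in>{j. 0 < j \<and> j < T \<and> q dvd j}. h (Mem (j - 1), Mem j)) = ?c * M * w"
      by (simp add: h_def)
    ultimately show ?thesis by (simp add: mult_ac)
  qed
  also have "(\<Sum>j<T. h (Ver (the (pv j)), Mem j)) = T * B * w"
    by (simp add: h_def)
  finally show ?thesis by (simp add: h_def algebra_simps)
qed

text \<open>The coding rate \<open>w\<close> passes to the flow rate by the conjecture. The flow
  rate is a supremum, so only rates \<open>r < w\<close> are sure to be exceeded by an actual flow,
  to which duality applies.\<close>

lemma io_bound:
  fixes r :: real
  assumes conj: undirected_k_pairs_conjecture and q: "q = M div B" and r: "0 \<le> r" "r < w" and N_pos: "N > 0"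
  shows "r * (L * (real N - card (near_pairs L)))
    \<le> L / 2 * (21 / 20 * N * w + 12 * mean (\<lambda>a. card (correction a))) + 3 * T * B * w"
proof -
  have "ennreal (real w) \<le> coding_rate network"
    unfolding coding_rate_def by (intro SUP_upper) (simp add: coding_achieves_network)
  also have "\<dots> \<le> flow_rate network"
    using conj k_pairs_instance_network by (simp add: undirected_k_pairs_conjecture_def)
  finally have le: "ennreal (real w) \<le> flow_rate network" .
  have "ennreal r < ennreal (real w)" using r by (simp add: ennreal_lessI)
  from less_le_trans[OF this le] obtain r' where r': "flow_achieves network r'" "ennreal r < ennreal r'"
    unfolding flow_rate_def less_SUP_iff by blast
  then have rr: "r < r'" using r by (meson ennreal_leI leD not_le_imp_less)
  \<comment> \<open>Distances are measured from the source block of the commodity, so its source has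
    potential \<open>0\<close>.\<close>
  define \<phi> where "\<phi> p x = potential L (p div B) (from_nat x)" for p x
  have "r' * (\<Sum>p<npairs network. \<phi> p (sink network p) - \<phi> p (source network p))
      \<le> (\<Sum>e\<in>edges network. (\<lambda>(x, y). len L (from_nat x) (from_nat y)) e * cap network e)"
  proof (rule flow_achieves_potential_bound[OF k_pairs_instance_network r'(1)])
    fix p x y assume "(x, y) \<in> edges network"
    then show "\<bar>\<phi> p y - \<phi> p x\<bar> \<le> (\<lambda>(x, y). len L (from_nat x) (from_nat y)) (x, y)"
      using potential_lipschitz by (auto simp: \<phi>_def edges_network)
  qed (use rr r N_pos in auto)
  also have "\<dots> = (\<Sum>(u, v)\<in>{(u, v). link u v}. len L u v * node_cap u v)"
    unfolding edges_network by (subst sum.reindex) (auto simp: inj_on_def intro!: sum.cong)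
  also have "\<dots> \<le> L / 2 * (21 / 20 * N * w + 12 * mean (\<lambda>a. card (correction a))) + 3 * T * B * w"
    by (rule sum_len_cap[OF q])
  finally have bound: "r' * (\<Sum>p<N. \<phi> p (sink network p) - \<phi> p (source network p)) \<le>
    L / 2 * (21 / 20 * N * w + 12 * mean (\<lambda>a. card (correction a))) + 3 * T * B * w" by simp
  have val: "\<phi> p (sink network p) - \<phi> p (source network p) = potential L (p div B) (Out (\<sigma> p div B))" for p
    by (simp add: \<phi>_def capped_dist_self)
  have "(\<Sum>p<N. if p \<in> near_pairs L then 0 else real L) \<le> (\<Sum>p<N. \<phi> p (sink network p) - \<phi> p (source network p))"
    unfolding val
  proof (rule sum_mono)
    fix p assume p: "p \<in> {..<N}"
    show "(if p \<in> near_pairs L then 0 else real L) \<le> potential L (p div B) (Out (\<sigma> p div B))"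
    proof (cases "p \<in> near_pairs L")
      case True
      then show ?thesis using potential_range(1) by presburger
    next
      case False
      then show ?thesis using p capped_dist_far by (auto simp: near_pairs_def split: option.split)
    qed
  qed
  moreover have "(\<Sum>p<N. if p \<in> near_pairs L then 0 else real L) = L * (real N - card (near_pairs L))"
  proof -
    have sub: "near_pairs L \<subseteq> {..<N}" by (auto simp: near_pairs_def)
    have "(\<Sum>p<N. if p \<in> near_pairs L then 0 else real L) = (\<Sum>p\<in>{..<N} - near_pairs L. real L)"
      by (intro sum.mono_neutral_cong_right) auto
    also have "\<dots> = L * (real N - card (near_pairs L))"
      using sub card_mono[OF _ sub] by (simp add: card_Diff_subset finite_subset of_nat_diff mult.commute)
    finally show ?thesis .
  qed
  moreover have "real N \<ge> card (near_pairs L)"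
    using card_mono[of "{..<N}" "near_pairs L"] by (auto simp: near_pairs_def)
  ultimately have "r * (L * (real N - card (near_pairs L)))
      \<le> r' * (\<Sum>p<N. \<phi> p (sink network p) - \<phi> p (source network p))"
    using rr r by (intro mult_mono) auto
  with bound show ?thesis by linarith
qed

end

subsection \<open>Near pairs and nearby codewords\<close>

definition transpose_index :: "nat \<Rightarrow> nat \<Rightarrow> nat" where
  "transpose_index n p = (p mod n) * n + p div n"

lemma transpose_index_less: "p < n * n \<Longrightarrow> transpose_index n p < n * n"
  and transpose_index_twice: "p < n * n \<Longrightarrow> transpose_index n (transpose_index n p) = p"
proof -
  assume p: "p < n * n"
  then have n: "n > 0" by (cases n) auto
  have d: "p div n < n" using p n by (simp add: div_less_iff_less_mult)
  have m: "p mod n < n" using n by simp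
  have "Suc (p mod n) * n \<le> n * n" using m by (intro mult_le_mono1) simp
  then show "transpose_index n p < n * n" using d by (simp add: transpose_index_def)
  show "transpose_index n (transpose_index n p) = p"
    using d n by (simp add: transpose_index_def)
qed

context
  fixes n B :: nat
  assumes B_dvd: "B dvd n" and B_pos: "B \<ge> 1"
begin

text \<open>No block straddles two rows, since \<open>B\<close> divides \<open>n\<close>.\<close>

lemma index_div: "(i * n + j) div B = i * (n div B) + j div B"
proof -
  obtain c where c: "n = B * c" using B_dvd by (rule dvdE)
  have "i * n + j = j + (i * c) * B" by (simp add: c)
  moreover have "(j + (i * c) * B) div B = i * c + j div B"
    using B_pos by (intro div_mult_self1) simp
  moreover have "n div B = c" using c B_pos by simp
  ultimately show ?thesis by (simp only:)
qed

text \<open>The entries of an input block share a row, so transposition puts them into different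
  rows and hence into different output blocks.\<close>

lemma transpose_index_block_inj:
  "inj_on (\<lambda>p. transpose_index n p div B) {p. p < n * n \<and> p div B = s}"
proof (rule inj_onI)
  fix p p' assume p: "p \<in> {p. p < n * n \<and> p div B = s}" and p': "p' \<in> {p. p < n * n \<and> p div B = s}"
    and eq: "transpose_index n p div B = transpose_index n p' div B"
  have n: "n > 0" using p by (cases n) auto
  have nB: "n div B > 0" using n B_dvd B_pos by (auto simp: div_greater_zero_iff dvd_imp_le)
  have "n = B * (n div B)" using B_dvd by simp
  then have row: "p div n = p' div n" using p p' by (metis (mono_tags, lifting) div_mult2_eq mem_Collect_eq)
  then have "p mod n = p' mod n"
    using eq nB unfolding transpose_index_def index_div by simp
  with row show "p = p'" by (metis div_mult_mod_eq)
qed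

text \<open>The output area may overlap the input, and an entry may keep its disk block. Within one
  row this happens at most once: from one entry to a later one the target block moves by at least
  \<open>n div B\<close>, the source block by less.\<close>

lemma card_transpose_index_shift:
  "card {p. p < n * n \<and> out + transpose_index n p div B = p div B} \<le> n"
proof -
  let ?S = "{p. p < n * n \<and> out + transpose_index n p div B = p div B}"
  have "inj_on (\<lambda>p. p div n) ?S"
  proof (rule inj_onI)
    fix p p' assume p: "p \<in> ?S" and p': "p' \<in> ?S" and row: "p div n = p' div n"
    have n: "n > 0" using p by (cases n) auto
    define j j' i where "j = p mod n" and "j' = p' mod n" and "i = p div n"
    have jj: "j < n" "j' < n" using n by (auto simp: j_def j'_def)
    have "out + (j * n + i) div B = (i * n + j) div B"
      using p by (simp add: transpose_index_def j_def i_def)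
    then have e: "out + (j * (n div B) + i div B) = i * (n div B) + j div B"
      unfolding index_div .
    have "out + (j' * n + i) div B = (i * n + j') div B"
      using p' row by (simp add: transpose_index_def j'_def i_def)
    then have e': "out + (j' * (n div B) + i div B) = i * (n div B) + j' div B"
      unfolding index_div .
    have aux: False if "x < y" "y < n"
      "out + (x * (n div B) + i div B) = i * (n div B) + x div B"
      "out + (y * (n div B) + i div B) = i * (n div B) + y div B" for x y
    proof -
      have "Suc x * (n div B) \<le> y * (n div B)" using that(1) by (intro mult_le_mono1) simp
      moreover have "y div B < n div B"
        using that(2) B_dvd by (intro less_mult_imp_div_less) simp
      ultimately show False using that(3,4) by (simp only: mult_Suc)
    qed
    have "j = j'" using aux[OF _ jj(2) e e'] aux[OF _ jj(1) e' e] by (meson linorder_neqE_nat)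
    with row show "p = p'" unfolding j_def j'_def by (metis div_mult_mod_eq)
  qed
  moreover have "(\<lambda>p. p div n) ` ?S \<subseteq> {..<n}"
  proof
    fix i assume "i \<in> (\<lambda>p. p div n) ` ?S"
    then obtain p where p: "p < n * n" "i = p div n" by auto
    then have "n > 0" by (cases n) auto
    then show "i \<in> {..<n}" using p by (simp add: div_less_iff_less_mult)
  qed
  ultimately show ?thesis
    using card_inj_on_le[of "\<lambda>p. p div n" ?S "{..<n}"] by simp
qed

end

lemma version_initial: "version K ad t d = Some v \<Longrightarrow> v < K \<Longrightarrow> v = d"
  by (induction t) (auto split: if_splits)

text \<open>Entries of one input block have different output blocks, so near pairs from this block
  are counted by near output blocks.\<close>

lemma (in coding_network) card_near_pairs:
  assumes inj: "\<And>s. inj_on (\<lambda>p. \<sigma> p div B) {p. p < N \<and> p div B = s}"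
  shows "card (near_pairs L) \<le> K * (q * (4 * q + 1) ^ (L - 1))"
proof -
  define S where "S s = {p \<in> near_pairs L. p div B = s}" for s
  have S: "finite (S s) \<and> card (S s) \<le> q * (4 * q + 1) ^ (L - 1)" for s
  proof -
    let ?O = "{k. \<exists>v. fv k = Some v \<and> version_cluster v \<in> ball (Inl s) (L - 1)}"
    have i: "inj_on (\<lambda>p. \<sigma> p div B) (S s)"
      by (rule inj_on_subset[OF inj[of s]]) (auto simp: S_def near_pairs_def)
    have o: "(\<lambda>p. \<sigma> p div B) ` S s \<subseteq> ?O" by (auto simp: S_def near_pairs_def)
    show ?thesis
      using inj_on_finite[OF i o card_near_outputs(1)]
        order_trans[OF card_inj_on_le[OF i o card_near_outputs(1)] card_near_outputs(2)] by blast
  qed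
  have "near_pairs L \<subseteq> (\<Union>s<K. S s)"
    using div_less_K by (auto simp: S_def near_pairs_def)
  then have "card (near_pairs L) \<le> card (\<Union>s<K. S s)"
    using S by (intro card_mono) auto
  also have "\<dots> \<le> (\<Sum>s<K. card (S s))" by (rule card_UN_le) simp
  also have "\<dots> \<le> (\<Sum>s<K. q * (4 * q + 1) ^ (L - 1))" using S by (intro sum_mono) auto
  finally show ?thesis by simp
qed

text \<open>At radius \<open>0\<close> the final version must be the source block itself, and an
  input version never leaves its address.\<close>

lemma (in coding_network) near_pairs_1: "near_pairs 1 \<subseteq> {p. p < N \<and> out + \<sigma> p div B = p div B}"
proof
  fix p assume "p \<in> near_pairs 1"
  then obtain v where p: "p < N" and v: "fv (\<sigma> p div B) = Some v" "version_cluster v = Inl (p div B)"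
    by (auto simp: near_pairs_def)
  then have vp: "v < K" "v = p div B" by (auto simp: version_cluster_def split: if_splits)
  obtain a where "a \<in> words N w" using words_nonempty by blast
  from writes[OF near[OF this] div_less_K[OF \<sigma>_less[OF p]]] v(1) version_initial vp(1)
  have "v = out + \<sigma> p div B" by metis
  with vp p show "p \<in> {p. p < N \<and> out + \<sigma> p div B = p div B}" by simp
qed

lemma card_words: "card (words N w) = 2 ^ (N * w)"
  by (simp add: words_def card_PiE power_mult[symmetric] mult.commute)

text \<open>Words are identified with subsets of the \<open>N * w\<close> bit positions. The Hamming
  distance to \<Gamma> is Lipschitz and vanishes on \<Gamma>, so concentration bounds its
  mean.\<close>

lemma exists_near_codeword:
  assumes \<Gamma>: "\<Gamma> \<subseteq> words N w" and large: "real (card \<Gamma>) \<ge> 2 powr (real (N * w) * (1 - 1 / 16384))"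
  shows "\<exists>near. (\<forall>a\<in>words N w. near a \<in> \<Gamma>) \<and>
    (\<Sum>a\<in>words N w. real (card {(p, b). p < N \<and> (b \<in> set_decode (a p)) \<noteq> (b \<in> set_decode (near a p))}))
      / card (words N w) \<le> real (N * w) / 128"
proof -
  define I where "I = {..<N} \<times> {..<w}"
  define \<beta> where "\<beta> a = {(p, b). p < N \<and> b \<in> set_decode (a p)}" for a :: "nat \<Rightarrow> nat"
  define dec where "dec X = (\<lambda>p\<in>{..<N}. set_encode (X `` {p}))" for X :: "(nat \<times> nat) set"
  define dist where "dist X Y = card (sym_diff X Y)" for X Y :: "(nat \<times> nat) set"
  have finI: "finite I" and cardI: "card I = N * w" by (simp_all add: I_def)
  have \<beta>_in: "\<beta> a \<in> Pow I" if "a \<in> words N w" for a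
    using that by (auto simp: \<beta>_def I_def words_def dest!: set_decode_subset)
  have enc_less: "set_encode S < 2 ^ w" if "S \<subseteq> {..<w}" for S
  proof -
    have "set_encode S \<le> set_encode {..<w}"
      using that finite_subset[OF that] by (intro subset_decode_imp_le) simp
    also have "set_encode {..<w} < 2 ^ w"
      by (induction w) (simp_all add: lessThan_Suc)
    finally show ?thesis .
  qed
  have bij: "bij_betw \<beta> (words N w) (Pow I)"
  proof (rule bij_betw_byWitness[where f' = dec])
    show "\<forall>a\<in>words N w. dec (\<beta> a) = a"
    proof
      fix a assume a: "a \<in> words N w"
      show "dec (\<beta> a) = a"
      proof
        fix p
        have "\<beta> a `` {p} = set_decode (a p)" if "p < N" using that by (auto simp: \<beta>_def)
        then show "dec (\<beta> a) p = a p"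
          using a by (cases "p < N") (auto simp: dec_def words_def PiE_iff extensional_def)
      qed
    qed
    show "\<forall>X\<in>Pow I. \<beta> (dec X) = X"
    proof
      fix X assume X: "X \<in> Pow I"
      have "finite X" using X finI by (meson PowD finite_subset)
      then have fin: "finite (X `` {p})" for p by (rule finite_Image)
      have "(p, b) \<in> \<beta> (dec X) \<longleftrightarrow> (p, b) \<in> X" for p b
      proof (cases "p < N")
        case True
        then show ?thesis by (simp add: \<beta>_def dec_def fin)
      next
        case False
        then have "(p, b) \<notin> X" using X by (auto simp: I_def)
        with False show ?thesis by (simp add: \<beta>_def)
      qed
      then show "\<beta> (dec X) = X" by (intro equalityI subrelI) blast+
    qed
    show "\<beta> ` words N w \<subseteq> Pow I" using \<beta>_in by blast
    show "dec ` Pow I \<subseteq> words N w"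
    proof
      fix a assume "a \<in> dec ` Pow I"
      then obtain X where X: "X \<subseteq> I" and a: "a = dec X" by auto
      have "X `` {p} \<subseteq> {..<w}" for p using X by (auto simp: I_def)
      then show "a \<in> words N w" by (auto simp: a dec_def words_def enc_less)
    qed
  qed
  have finW: "finite (words N w)" by (rule finite_words)
  have fin\<Gamma>: "finite \<Gamma>" using \<Gamma> finW by (rule finite_subset)
  have ne: "\<Gamma> \<noteq> {}" using large by (auto simp: not_le)
  define f where "f X = Min ((\<lambda>g. dist X (\<beta> g)) ` \<Gamma>)" for X
  have f_le: "f X \<le> dist X (\<beta> g)" if "g \<in> \<Gamma>" for X g
    using that fin\<Gamma> by (simp add: f_def)
  have f_attained: "\<exists>g\<in>\<Gamma>. f X = dist X (\<beta> g)" for X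
  proof -
    have "f X \<in> (\<lambda>g. dist X (\<beta> g)) ` \<Gamma>" unfolding f_def using fin\<Gamma> ne by (intro Min_in) auto
    then show ?thesis by blast
  qed
  then obtain near' where near': "\<And>X. near' X \<in> \<Gamma>" "\<And>X. f X = dist X (\<beta> (near' X))" by metis
  have fin\<beta>: "finite (\<beta> g)" if "g \<in> \<Gamma>" for g
    using \<beta>_in that \<Gamma> finI by (meson PowD finite_subset subsetD)
  have dist_le: "dist X Y \<le> dist X' Y + 1"
    if "finite X" "finite X'" "finite Y" "X \<subseteq> insert i X'" "X' \<subseteq> insert i X" for X X' Y i
  proof -
    have "dist X Y \<le> card (insert i (sym_diff X' Y))"
      unfolding dist_def using that by (intro card_mono) auto
    also have "\<dots> \<le> dist X' Y + 1"
      using that by (simp add: dist_def card_insert_if)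
    finally show ?thesis .
  qed
  have f_le_Suc: "f X \<le> f X' + 1"
    if "finite X" "finite X'" "X \<subseteq> insert i X'" "X' \<subseteq> insert i X" for X X' i
    using f_le[OF near'(1), of X X'] dist_le[OF that(1,2) fin\<beta>[OF near'(1)] that(3,4), of X'] near'(2)[of X']
    by linarith
  \<comment> \<open>The choice \<open>t = 1 / 64\<close> makes both error terms equal to
    \<open>1 / 256\<close>.\<close>
  have "(\<Sum>X\<in>Pow I. real (f X)) / 2 ^ card I \<le> (1 / 16384 / (1 / 64) + 1 / 64 / 4) * card I"
  proof (rule cube_mean_distance_le[OF finI, where \<Gamma> = "\<beta> ` \<Gamma>"])
    fix X i assume X: "X \<subseteq> I"
    then have "finite X" using finI by (rule finite_subset)
    then have "f (insert i X) \<le> f X + 1" "f X \<le> f (insert i X) + 1"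
      using f_le_Suc[of "insert i X" X i] f_le_Suc[of X "insert i X" i] by blast+
    then show "\<bar>real (f (insert i X)) - real (f X)\<bar> \<le> 1" by linarith
  next
    show "\<beta> ` \<Gamma> \<subseteq> Pow I" using \<beta>_in \<Gamma> by blast
    show "real (f X) = 0" if X: "X \<in> \<beta> ` \<Gamma>" for X
    proof -
      obtain g where "g \<in> \<Gamma>" "X = \<beta> g" using X by blast
      then show ?thesis using f_le[of g X] by (simp add: dist_def)
    qed
    have "card (\<beta> ` \<Gamma>) = card \<Gamma>"
      by (rule card_image[OF inj_on_subset[OF bij_betw_imp_inj_on[OF bij] \<Gamma>]])
    then show "2 powr (real (card I) * (1 - 1 / 16384)) \<le> real (card (\<beta> ` \<Gamma>))"
      using large by (simp add: cardI)
  qed auto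
  also have "(1 / 16384 / (1 / 64) + 1 / 64 / 4) * real (card I) = real (N * w) / 128"
    by (simp add: cardI)
  also have "(\<Sum>X\<in>Pow I. real (f X)) = (\<Sum>a\<in>words N w. real (f (\<beta> a)))"
    by (rule sum.reindex_bij_betw[OF bij, symmetric])
  also have "(2 :: real) ^ card I = card (words N w)" by (simp add: card_words cardI)
  finally have mean: "(\<Sum>a\<in>words N w. real (f (\<beta> a))) / card (words N w) \<le> real (N * w) / 128" .
  have "f (\<beta> a) = card {(p, b). p < N \<and> (b \<in> set_decode (a p)) \<noteq> (b \<in> set_decode (near' (\<beta> a) p))}" for a
  proof -
    have "sym_diff (\<beta> a) (\<beta> (near' (\<beta> a)))
        = {(p, b). p < N \<and> (b \<in> set_decode (a p)) \<noteq> (b \<in> set_decode (near' (\<beta> a) p))}"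
      by (auto simp: \<beta>_def)
    then show ?thesis using near'(2)[of "\<beta> a"] by (simp add: dist_def)
  qed
  with mean near'(1) show ?thesis by (intro exI[of _ "\<lambda>a. near' (\<beta> a)"]) simp
qed

lemma exists_large_fibre:
  assumes "finite A" "finite C" "C \<noteq> {}" "f ` A \<subseteq> C"
  shows "\<exists>c\<in>C. card A \<le> card C * card {x \<in> A. f x = c}"
proof (rule ccontr)
  assume "\<not> ?thesis"
  then have "card C * card {x \<in> A. f x = c} < card A" if "c \<in> C" for c using that by force
  then have "(\<Sum>c\<in>C. card C * card {x \<in> A. f x = c}) < (\<Sum>c\<in>C. card A)"
    using assms by (intro sum_strict_mono) auto
  moreover have "(\<Sum>c\<in>C. card {x \<in> A. f x = c}) = card A"
  proof -
    have "A = (\<Union>c\<in>C. {x \<in> A. f x = c})" using assms(4) by auto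
    moreover have "card (\<Union>c\<in>C. {x \<in> A. f x = c}) = (\<Sum>c\<in>C. card {x \<in> A. f x = c})"
      using assms by (intro card_UN_disjoint) auto
    ultimately show ?thesis by simp
  qed
  ultimately show False by (simp add: sum_distrib_left[symmetric])
qed

subsection \<open>Deterministic algorithms\<close>

text \<open>By \<open>few\<close>, fixing the description of a run shrinks \<open>G\<close> only to
  exponent \<open>1 - 1 / 16384\<close>. The condition on \<open>L\<close> leaves at most a tenth of
  the pairs near.\<close>

lemma deterministic_io_bound:
  fixes n M B w out Tm L :: nat and alg :: algorithm and G :: "(nat \<Rightarrow> nat) set"
  defines "K \<equiv> n * (n div B)" and "q \<equiv> M div B"
  assumes conj: undirected_k_pairs_conjecture
    and n: "n \<ge> 10" and w: "w \<ge> 1" and B: "B \<ge> 1" "B dvd n" "B \<le> M"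
    and valid: "valid_algorithm M B w alg"
    and G: "G \<subseteq> words (n * n) w" and half: "card (words (n * n) w) \<le> 2 * card G"
    and correct: "\<And>a. a \<in> G \<Longrightarrow> \<exists>t\<le>Tm. \<forall>k<K. snd (run M B alg (flat_disk B K a) t) (out + k)
      = map (\<lambda>l. a (transpose_index n (k * B + l))) [0..<B]"
    and few: "real (2 * ((Tm + 1) * ((K + Tm + 1) * (K + 1)) ^ Tm)) \<le> 2 powr (real (n * n * w) / 16384)"
    and L: "L = 1 \<or> 10 * (q * (4 * q + 1) ^ (L - 1)) \<le> B"
  shows "real L * real (n * n) \<le> 13 * (real Tm * real B)"
proof -
  let ?N = "n * n"
  define ad where "ad a = access M B alg (flat_disk B K a)" for a
  define good where "good a t \<longleftrightarrow> t \<le> Tm \<and> (\<forall>k<K. snd (run M B alg (flat_disk B K a) t) (out + k)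
      = map (\<lambda>l. a (transpose_index n (k * B + l))) [0..<B])" for a t
  define tm where "tm a = (SOME t. good a t)" for a
  have tm: "good a (tm a)" if "a \<in> G" for a
  proof -
    have "\<exists>t. good a t" using correct[OF that] unfolding good_def by blast
    then show ?thesis unfolding tm_def by (rule someI_ex)
  qed
  \<comment> \<open>A step is described by the version it accesses, which fixes \<open>pv\<close>,
    and by its window, which fixes \<open>fv\<close>; there are only polynomially many such
    pairs.\<close>
  define pat where "pat a i = (version K (ad a) i (ad a i), window out K (ad a i))" for a i
  define F where "F a = (tm a, \<lambda>i\<in>{..<Tm}. pat a i)" for a
  define S where "S = insert None (Some ` {..<K + Tm}) \<times> insert None (Some ` {..<K})"
  define C where "C = {..Tm} \<times> PiE {..<Tm} (\<lambda>_. S)"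
  have finS: "finite S" by (simp add: S_def)
  have cardS: "card S = (K + Tm + 1) * (K + 1)"
    unfolding S_def card_cartesian_product by (simp add: card_insert_if card_image image_iff)
  have finC: "finite C" unfolding C_def by (intro finite_SigmaI finite_PiE finS) auto
  have cardC: "card C = (Tm + 1) * ((K + Tm + 1) * (K + 1)) ^ Tm"
    unfolding C_def card_cartesian_product by (simp add: card_PiE cardS)
  have pat_S: "pat a i \<in> S" if "i < Tm" for a i
  proof -
    have "version K (ad a) i (ad a i) \<in> insert None (Some ` {..<K + Tm})"
      using version_less[of K "ad a" i "ad a i"] that
      by (cases "version K (ad a) i (ad a i)") fastforce+
    moreover have "window out K (ad a i) \<in> insert None (Some ` {..<K})"
      by (auto simp: window_def)
    ultimately show ?thesis unfolding pat_def S_def by (rule SigmaI)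
  qed
  have FC: "F ` G \<subseteq> C"
  proof (rule image_subsetI)
    fix a assume "a \<in> G"
    then have "tm a \<le> Tm" using tm by (simp add: good_def)
    then show "F a \<in> C" using pat_S by (simp add: F_def C_def restrict_PiE_iff)
  qed
  have finG: "finite G" using G finite_words by (rule finite_subset)
  have "G \<noteq> {}" using half finite_words[of ?N w] words_nonempty[of ?N w] by (auto simp: card_gt_0_iff)
  then have "C \<noteq> {}" using FC by auto
  from exists_large_fibre[OF finG finC this FC] obtain c
    where c: "c \<in> C" "card G \<le> card C * card {a \<in> G. F a = c}" by blast
  define \<Gamma> where "\<Gamma> = {a \<in> G. F a = c}"
  have "(2 :: real) powr real (?N * w) = real (card (words ?N w))"
    unfolding card_words by (subst powr_realpow) auto
  also have "\<dots> \<le> real (2 * (card C * card \<Gamma>))"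
    using half c(2) unfolding \<Gamma>_def by (intro of_nat_mono) linarith
  also have "\<dots> = real (2 * card C) * card \<Gamma>" by simp
  also have "\<dots> \<le> 2 powr (real (?N * w) / 16384) * card \<Gamma>"
    using few unfolding cardC by (intro mult_right_mono) auto
  finally have "2 powr real (?N * w) / 2 powr (real (?N * w) / 16384) \<le> card \<Gamma>"
    by (simp add: divide_le_eq mult.commute)
  then have large: "2 powr (real (?N * w) * (1 - 1 / 16384)) \<le> card \<Gamma>"
    by (simp only: powr_diff[symmetric] right_diff_distrib mult_1_right times_divide_eq_right)
  have \<Gamma>W: "\<Gamma> \<subseteq> words ?N w" using G by (auto simp: \<Gamma>_def)
  from exists_near_codeword[OF \<Gamma>W large] obtain near
    where near: "\<And>a. a \<in> words ?N w \<Longrightarrow> near a \<in> \<Gamma>"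
      and mean: "(\<Sum>a\<in>words ?N w. real (card {(p, b). p < ?N \<and>
        (b \<in> set_decode (a p)) \<noteq> (b \<in> set_decode (near a p))})) / card (words ?N w) \<le> real (?N * w) / 128"
    by blast
  obtain g0 where g0: "g0 \<in> \<Gamma>" using near words_nonempty by blast
  define T where "T = tm g0"
  define pv where "pv i = version K (ad g0) i (ad g0 i)" for i
  define fv where "fv k = version K (ad g0) T (out + k)" for k
  have T: "T \<le> Tm" using tm[of g0] g0 by (simp add: T_def good_def \<Gamma>_def)
  have F_eq: "tm g = T" "i < Tm \<Longrightarrow> pat g i = pat g0 i" if "g \<in> \<Gamma>" for g i
  proof -
    have "F g = F g0" using that g0 by (simp add: \<Gamma>_def)
    then have "tm g = tm g0" "restrict (pat g) {..<Tm} = restrict (pat g0) {..<Tm}"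
      by (simp_all add: F_def)
    then show "tm g = T" "i < Tm \<Longrightarrow> pat g i = pat g0 i"
      by (auto simp: T_def dest: fun_cong[of _ _ i])
  qed
  have NK: "?N = K * B" using B by (simp add: K_def)
  interpret coding_network K q pv fv alg M out w B ?N T "transpose_index n" \<Gamma> near
  proof
    show "transpose_index n p < ?N" if "p < ?N" for p
      using that by (rule transpose_index_less)
    show "transpose_index n (transpose_index n p) = p" if "p < ?N" for p
      using that by (rule transpose_index_twice)
    show "?N = K * B" by (rule NK)
    show "\<Gamma> \<subseteq> words ?N w" by (rule \<Gamma>W)
    show "near a \<in> \<Gamma>" if "a \<in> words ?N w" for a using that by (rule near)
    show "1 \<le> q" using B by (simp add: q_def div_greater_zero_iff Suc_le_eq)
    show "i = j" if "pv i = Some v" "pv j = Some v" for i j v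
      using that unfolding pv_def by (rule version_accessed_inj)
    show "k = l" if "fv k = Some v" "fv l = Some v" for k l v
      using version_inj[OF that[unfolded fv_def]] by simp
    show "v < K + j" if "pv j = Some v" for j v using that unfolding pv_def by (rule version_less)
    show "v < K + T" if "fv k = Some v" for k v using that unfolding fv_def by (rule version_less)
    fix g assume g: "g \<in> \<Gamma>"
    show "version K (access M B alg (flat_disk B K g)) i (access M B alg (flat_disk B K g) i) = pv i"
      if "i < T" for i
      using F_eq(2)[OF g, of i] that T unfolding ad_def[symmetric] by (simp add: pat_def pv_def)
    show "version K (access M B alg (flat_disk B K g)) T (out + k) = fv k" if k: "k < K" for k
      unfolding ad_def[symmetric] fv_def
    proof (rule version_window_cong[OF _ k])
      show "window out K (ad g i) = window out K (ad g0 i)" if "i < T" for i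
        using F_eq(2)[OF g, of i] that T by (simp add: pat_def)
    qed
    show "snd (run M B alg (flat_disk B K g) T) (out + k) = map (\<lambda>l. g (transpose_index n (k * B + l))) [0..<B]"
      if "k < K" for k
      using tm[of g] g that F_eq(1)[OF g] by (simp add: good_def \<Gamma>_def)
  qed (use B w valid in simp_all)
  have near_few: "real (card (near_pairs L)) \<le> real ?N / 10"
  proof (cases "L = 1")
    case True
    have "card (near_pairs L) \<le> card {p. p < ?N \<and> out + transpose_index n p div B = p div B}"
      unfolding True using near_pairs_1 by (intro card_mono) auto
    also have "\<dots> \<le> n" by (rule card_transpose_index_shift[OF B(2,1)])
    finally have "real (card (near_pairs L)) \<le> real n" by simp
    \<comment> \<open>At most one pair per row is near, which is a tenth of all pairs or less once
      \<open>n \<ge> 10\<close>.\<close>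
    moreover have "10 * n \<le> n * n" using n by (rule mult_le_mono1)
    then have "10 * real n \<le> real ?N" by (metis of_nat_le_iff of_nat_mult of_nat_numeral)
    ultimately show ?thesis by linarith
  next
    case False
    have "card (near_pairs L) \<le> K * (q * (4 * q + 1) ^ (L - 1))"
      by (rule card_near_pairs[OF transpose_index_block_inj[OF B(2,1)]])
    then have "10 * card (near_pairs L) \<le> K * (10 * (q * (4 * q + 1) ^ (L - 1)))" by linarith
    also have "\<dots> \<le> K * B" using L False by (intro mult_le_mono2) auto
    finally have "10 * card (near_pairs L) \<le> ?N" by (simp add: NK)
    then have "10 * real (card (near_pairs L)) \<le> real ?N" by (metis of_nat_le_iff of_nat_mult of_nat_numeral)
    then show ?thesis by linarith
  qed
  have qM: "q = M div B" by (simp add: q_def)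
  define \<mu> where "\<mu> = coding_network.mean w ?N (\<lambda>a. card (correction a))"
  have \<mu>: "\<mu> \<le> real (?N * w) / 128"
    using mean by (simp add: \<mu>_def local.mean_def correction_def)
  \<comment> \<open>The rate \<open>9 / 10 * w\<close> is a convenient value below \<open>w\<close>.
    With nine tenths of the pairs far, the demand \<open>81 / 100\<close> exceeds the hub's share
    \<open>21 / 40 + 3 / 64\<close>, so the algorithm's own edges must carry the rest.\<close>
  have "9 / 10 * real w * (real L * (real ?N - card (near_pairs L)))
      \<le> real L / 2 * (21 / 20 * real ?N * real w + 12 * \<mu>) + real (3 * T * B * w)"
    unfolding \<mu>_def using n w by (intro io_bound[OF conj qM]) auto
  moreover have "9 / 10 * real w * (real L * (9 / 10 * real ?N))
      \<le> 9 / 10 * real w * (real L * (real ?N - card (near_pairs L)))"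
    using near_few by (intro mult_left_mono) auto
  moreover have "real L / 2 * (21 / 20 * real ?N * real w + 12 * \<mu>)
      \<le> real L / 2 * (21 / 20 * real ?N * real w + 12 * (real (?N * w) / 128))"
    using \<mu> by (intro mult_left_mono add_left_mono) auto
  moreover have "real (3 * T * B * w) \<le> 3 * (real Tm * real B) * real w"
    using T by (simp add: mult_right_mono)
  ultimately have "9 / 10 * real w * (real L * (9 / 10 * real ?N))
      \<le> real L / 2 * (21 / 20 * real ?N * real w + 12 * (real (?N * w) / 128)) + 3 * (real Tm * real B) * real w"
    by linarith
  then have "(real L * real ?N * (81 / 100 - 21 / 40 - 3 / 64)) * real w \<le> (3 * (real Tm * real B)) * real w"
    by (simp add: algebra_simps)
  then have final: "real L * real ?N * (81 / 100 - 21 / 40 - 3 / 64) \<le> 3 * (real Tm * real B)"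
    using w by (subst (asm) mult_le_cancel_right) auto
  have "x \<le> 13 * y" if "x * (81 / 100 - 21 / 40 - 3 / 64) \<le> 3 * y" "0 \<le> x" for x y :: real
    using that by (simp add: field_simps)
  from this[OF final] show ?thesis by simp
qed

subsection \<open>Randomized algorithms on flattened matrices\<close>

definition mat_of :: "nat \<Rightarrow> (nat \<Rightarrow> nat) \<Rightarrow> nat mat" where
  "mat_of n a = mat n n (\<lambda>(i, j). a (i * n + j))"

lemma flat_index_less: "i < n \<Longrightarrow> j < n \<Longrightarrow> i * n + j < n * (n :: nat)"
proof -
  assume "i < n" "j < n"
  then have "Suc i * n \<le> n * n" by (intro mult_le_mono1) simp
  with \<open>j < n\<close> show ?thesis by simp
qed

lemma mat_of_word_matrices: "a \<in> words (n * n) w \<Longrightarrow> mat_of n a \<in> word_matrices n w"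
proof -
  assume a: "a \<in> words (n * n) w"
  have "a (i * n + j) < 2 ^ w" if "i < n" "j < n" for i j
    using PiE_mem[OF a[unfolded words_def], of "i * n + j"] flat_index_less[OF that] by simp
  then show ?thesis by (simp add: mat_of_def word_matrices_def)
qed

context
  fixes n B :: nat
  assumes B_dvd: "B dvd n" and B_pos: "B \<ge> 1"
begin

lemma block_coordinates:
  assumes k: "k < n * (n div B)" and l: "l < B"
  defines "i \<equiv> k div (n div B)" and "j \<equiv> k mod (n div B)"
  shows "i < n" "j < n div B" "j * B + l < n" "k * B + l = i * n + (j * B + l)" "i * (n div B) + j = k"
proof -
  have nB: "n div B > 0" using k by (cases "n div B") auto
  have n: "n = n div B * B" using B_dvd by simp
  show "i < n" unfolding i_def using k nB by (simp add: div_less_iff_less_mult)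
  show j: "j < n div B" unfolding j_def using nB by simp
  have "Suc j * B \<le> n div B * B" using j by (intro mult_le_mono1) simp
  then show "j * B + l < n" using l n by simp
  show e: "i * (n div B) + j = k" unfolding i_def j_def by (rule div_mult_mod_eq)
  have "k * B + l = (i * (n div B) + j) * B + l" by (simp only: e)
  also have "\<dots> = i * (n div B * B) + (j * B + l)" by (simp add: algebra_simps)
  finally show "k * B + l = i * n + (j * B + l)" using n by simp
qed

lemma input_disk_mat_of: "input_disk n B (mat_of n a) = flat_disk B (n * (n div B)) a"
proof
  fix d
  show "input_disk n B (mat_of n a) d = flat_disk B (n * (n div B)) a d"
  proof (cases "d < n * (n div B)")
    case True
    have "row_block B (mat_of n a) (d div (n div B)) (d mod (n div B)) = map (\<lambda>l. a (d * B + l)) [0..<B]"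
      unfolding row_block_def
    proof (rule map_cong[OF refl])
      fix l assume "l \<in> set [0..<B]"
      then have l: "l < B" by simp
      note c = block_coordinates[OF True l]
      show "mat_of n a $$ (d div (n div B), d mod (n div B) * B + l) = a (d * B + l)"
        unfolding c(4) using c(1,3) by (simp add: mat_of_def)
    qed
    then show ?thesis using True by (simp add: input_disk_def flat_disk_def)
  qed (simp add: input_disk_def flat_disk_def)
qed

lemma stored_transpose_mat_of:
  assumes "stored_at n B D out (transpose_mat (mat_of n a))" and k: "k < n * (n div B)"
  shows "D (out + k) = map (\<lambda>l. a (transpose_index n (k * B + l))) [0..<B]"
proof -
  define i j where "i = k div (n div B)" and "j = k mod (n div B)"
  note c = block_coordinates[OF k, folded i_def j_def]
  have "0 < B" using B_pos by simp
  note c0 = c[OF this]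
  have "D (out + i * (n div B) + j) = row_block B (transpose_mat (mat_of n a)) i j"
    using assms(1) c0(1,2) unfolding stored_at_def by blast
  also have "out + i * (n div B) + j = out + k" using c0(5) by simp
  also have "row_block B (transpose_mat (mat_of n a)) i j = map (\<lambda>l. a (transpose_index n (k * B + l))) [0..<B]"
    unfolding row_block_def
  proof (rule map_cong[OF refl])
    fix l assume "l \<in> set [0..<B]"
    then have l: "l < B" by simp
    have "transpose_index n (k * B + l) = (j * B + l) * n + i"
      unfolding c(4)[OF l] transpose_index_def using c(1,3)[OF l] by simp
    then show "transpose_mat (mat_of n a) $$ (i, j * B + l) = a (transpose_index n (k * B + l))"
      using c(1,3)[OF l] by (simp add: mat_of_def transpose_mat_def)
  qed
  finally show ?thesis .
qed

end

text \<open>Averaging: the expected number of events that occur is at least half of their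
  number.\<close>

lemma (in prob_space) exists_point_in_half:
  fixes \<Omega> :: "'b set"
  assumes fin: "finite \<Omega>" and E: "\<And>a. a \<in> \<Omega> \<Longrightarrow> E a \<in> events" "\<And>a. a \<in> \<Omega> \<Longrightarrow> prob (E a) \<ge> 1 / 2"
  shows "\<exists>x\<in>space M. card \<Omega> \<le> 2 * card {a \<in> \<Omega>. x \<in> E a}"
proof (rule ccontr)
  assume "\<not> ?thesis"
  then have less: "2 * card {a \<in> \<Omega>. x \<in> E a} < card \<Omega>" if "x \<in> space M" for x
    using that by force
  define h where "h x = (\<Sum>a\<in>\<Omega>. indicator (E a) x :: real)" for x
  have h: "h x = card {a \<in> \<Omega>. x \<in> E a}" for x
    using fin by (simp add: h_def indicator_def sum.If_cases Int_def)
  \<comment> \<open>Integrality turns the strict inequality at each point into a uniform gap, which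
    survives integration.\<close>
  have "h x \<le> (real (card \<Omega>) - 1) / 2" if "x \<in> space M" for x
  proof -
    have "2 * card {a \<in> \<Omega>. x \<in> E a} + 1 \<le> card \<Omega>" using less[OF that] by simp
    then have "real (2 * card {a \<in> \<Omega>. x \<in> E a} + 1) \<le> real (card \<Omega>)" by (rule of_nat_mono)
    then show ?thesis unfolding h by simp
  qed
  moreover have int: "integrable M (indicator (E a) :: _ \<Rightarrow> real)" if "a \<in> \<Omega>" for a
    using E(1)[OF that] by (simp add: integrable_indicator_iff less_top[symmetric])
  then have "integrable M h"
    unfolding h_def by (rule Bochner_Integration.integrable_sum)
  ultimately have "expectation h \<le> (real (card \<Omega>) - 1) / 2"
    by (intro integral_le_const) auto
  moreover have "expectation h = (\<Sum>a\<in>\<Omega>. prob (E a))"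
    unfolding h_def using int E(1) sets.sets_into_space
    by (subst Bochner_Integration.integral_sum) (auto intro!: sum.cong simp: Int_absorb2)
  moreover have "(\<Sum>a\<in>\<Omega>. prob (E a)) \<ge> (\<Sum>a\<in>\<Omega>. 1 / 2)"
    using E(2) by (rule sum_mono)
  ultimately show False by simp
qed

text \<open>Markov's inequality, at a threshold six times the bound on the expectation.\<close>

lemma prob_many_ios:
  assumes R: "prob_space R" and meas: "X \<in> R \<rightarrow>\<^sub>M count_space UNIV"
    and less: "(\<integral>\<^sup>+ x. ennreal_of_enat (X x) \<partial>R) < ennreal Z" and Z: "6 * Z \<le> real T + 1" "0 \<le> Z"
  shows "{x \<in> space R. enat T < X x} \<in> sets R" and "measure R {x \<in> space R. enat T < X x} \<le> 1 / 6"
proof -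
  interpret prob_space R by (rule R)
  let ?S = "{x \<in> space R. enat T < X x}"
  have "?S = X -` {e. enat T < e} \<inter> space R" by auto
  then show S: "?S \<in> sets R" using measurable_sets[OF meas, of "{e. enat T < e}"] by simp
  have "ennreal (real (T + 1) * prob ?S) = ennreal (real (T + 1)) * emeasure R ?S"
    by (simp add: ennreal_mult emeasure_eq_measure)
  also have "\<dots> = (\<integral>\<^sup>+ x. ennreal (real (T + 1)) * indicator ?S x \<partial>R)"
    using S by (simp add: nn_integral_cmult_indicator)
  also have "\<dots> \<le> (\<integral>\<^sup>+ x. ennreal_of_enat (X x) \<partial>R)"
  proof (rule nn_integral_mono)
    fix x assume "x \<in> space R"
    show "ennreal (real (T + 1)) * indicator ?S x \<le> ennreal_of_enat (X x)"
    proof (cases "enat T < X x")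
      case True
      \<comment> \<open>More than \<open>T\<close> I/Os means at least \<open>T + 1\<close>, also
        when the count is infinite.\<close>
      then have "enat (T + 1) \<le> X x" by (metis Suc_eq_plus1 Suc_ile_eq)
      then have "ennreal_of_enat (enat (T + 1)) \<le> ennreal_of_enat (X x)" by (simp only: ennreal_of_enat_le_iff)
      moreover have "ennreal_of_enat (enat (T + 1)) = ennreal (real (T + 1))"
        by (simp only: ennreal_of_enat_enat ennreal_of_nat_eq_real_of_nat)
      ultimately have "ennreal (real (T + 1)) * 1 \<le> ennreal_of_enat (X x)" by (simp only: mult_1_right)
      moreover have "ennreal (real (T + 1)) * indicator ?S x \<le> ennreal (real (T + 1)) * 1"
        by (intro mult_left_mono) (auto simp: indicator_def)
      ultimately show ?thesis by (rule order_trans[rotated])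
    qed simp
  qed
  also have "\<dots> < ennreal Z" by (rule less)
  finally have "real (T + 1) * prob ?S < Z" by (simp add: ennreal_less_iff)
  then have "6 * (real (T + 1) * prob ?S) < 6 * Z" by (rule mult_strict_left_mono) simp
  also have "6 * Z \<le> real (T + 1) * 1" using Z by simp
  finally have "real (T + 1) * (6 * prob ?S) < real (T + 1) * 1"
    by (simp only: mult.left_commute)
  then have "6 * prob ?S < 1" by (rule mult_left_less_imp_less) simp
  then show "prob ?S \<le> 1 / 6" by simp
qed

text \<open>With \<open>m\<close> the number of input bits, the count is at most
  \<open>m ^ (2 + 3 * T)\<close>. Its binary logarithm is at most
  \<open>m / 32768 + 3 * m / 100000\<close>, which is just below \<open>m / 16384\<close>.\<close>

lemma few_patterns:
  fixes K T m :: nat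
  assumes m: "m \<ge> 10" "K \<le> m" "T \<le> m" and T: "real T * log 2 m \<le> real m / 100000"
    and log: "2 * log 2 m \<le> real m / 32768"
  shows "real (2 * ((T + 1) * ((K + T + 1) * (K + 1)) ^ T)) \<le> 2 powr (real m / 16384)"
proof -
  have "(K + T + 1) * (K + 1) \<le> (2 * m + 1) * (m + 1)"
    using m by (intro mult_le_mono) auto
  also have "\<dots> \<le> (3 * m) * (2 * m)" using m by (intro mult_le_mono) auto
  also have "\<dots> = 6 * m ^ 2" by (simp add: power2_eq_square)
  also have "\<dots> \<le> m * m ^ 2" using m by (intro mult_le_mono1) simp
  also have "\<dots> = m ^ 3" by (simp add: power3_eq_cube power2_eq_square)
  finally have base: "(K + T + 1) * (K + 1) \<le> m ^ 3" .
  have "2 * (T + 1) \<le> 4 * m" using m by simp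
  also have "\<dots> \<le> m ^ 2" using m unfolding power2_eq_square by (intro mult_le_mono1) simp
  finally have "2 * (T + 1) * ((K + T + 1) * (K + 1)) ^ T \<le> m ^ 2 * (m ^ 3) ^ T"
    using base by (intro mult_le_mono power_mono) auto
  also have "\<dots> = m ^ (2 + 3 * T)" by (simp only: power_add power_mult)
  finally have "real (2 * (T + 1) * ((K + T + 1) * (K + 1)) ^ T) \<le> real (m ^ (2 + 3 * T))"
    by (rule of_nat_mono)
  also have "\<dots> = 2 powr (log 2 m * real (2 + 3 * T))"
  proof -
    have "2 powr (log 2 m * real (2 + 3 * T)) = (2 powr log 2 m) powr real (2 + 3 * T)"
      by (simp only: powr_powr)
    also have "2 powr log 2 m = real m" using m by simp
    also have "real m powr real (2 + 3 * T) = real m ^ (2 + 3 * T)"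
      using m by (intro powr_realpow) simp
    finally show ?thesis by (simp only: of_nat_power)
  qed
  also have "log 2 m * real (2 + 3 * T) = 2 * log 2 m + 3 * (real T * log 2 m)"
    by (simp add: algebra_simps)
  also have "\<dots> \<le> real m / 16384" using T log by linarith
  finally show ?thesis by (simp only: mult.assoc) simp
qed

text \<open>With \<open>y = 2 * M / B\<close> one has \<open>y powr lam = B\<close> and
  \<open>4 * q + 1 \<le> y ^ 3\<close>, so about \<open>lam / 6\<close> levels of growth reach at
  most the square root of \<open>B\<close>. The other square root absorbs the factor
  \<open>10\<close> once \<open>lam \<ge> 7\<close>; below that, \<open>L = 1\<close> will
  do.\<close>

lemma distance_choice:
  fixes B M :: nat
  assumes B: "B \<ge> 1" "B \<le> M"
  defines "lam \<equiv> log (2 * real M / real B) (real B)" and "q \<equiv> M div B"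
  shows "\<exists>L. (L = 1 \<or> 10 * (q * (4 * q + 1) ^ (L - 1)) \<le> B) \<and> L \<ge> 1 \<and> lam \<le> 12 * real L"
proof (cases "lam < 7")
  case True
  then show ?thesis by (intro exI[of _ 1]) simp
next
  case False
  define y where "y = 2 * real M / real B"
  have y: "y \<ge> 2" using B by (simp add: y_def field_simps)
  have By: "y powr lam = B" unfolding lam_def y_def[symmetric] using y B by simp
  define L where "L = nat \<lfloor>lam / 6\<rfloor>"
  have L: "real L \<le> lam / 6" "lam / 6 < real L + 1" "L \<ge> 1"
    using False by (auto simp: L_def le_nat_floor) linarith+
  have q: "real q \<le> y / 2"
  proof -
    have "real (q * B) \<le> real M" unfolding q_def by (intro of_nat_mono) simp
    then show ?thesis using B by (simp add: y_def field_simps)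
  qed
  have y3: "2 * y + 1 \<le> y ^ 3"
  proof -
    have "4 * y \<le> y ^ 2 * y" using y power_mono[of 2 y 2] by (intro mult_right_mono) auto
    moreover have "y ^ 2 * y = y ^ 3" by (simp add: power3_eq_cube power2_eq_square)
    ultimately show ?thesis using y by linarith
  qed
  define s where "s = y powr (lam / 2)"
  have s: "s * s = B" unfolding s_def powr_add[symmetric] using By by simp
  have "(2 :: real) powr 7 \<le> y powr lam"
    using y False by (intro powr_mono_both) auto
  then have "128 \<le> s * s" using s By by simp
  then have s10: "10 \<le> s"
    using mult_strict_mono[of s 10 s 10] by (fastforce simp: s_def not_le)
  have "real (q * (4 * q + 1) ^ (L - 1)) \<le> real ((4 * q + 1) * (4 * q + 1) ^ (L - 1))"
    by (intro of_nat_mono mult_le_mono1) simp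
  also have "(4 * q + 1) * (4 * q + 1) ^ (L - 1) = (4 * q + 1) ^ L"
    using L(3) by (cases L) auto
  also have "real ((4 * q + 1) ^ L) = (4 * real q + 1) ^ L" by (simp add: add.commute)
  also have "\<dots> \<le> (y ^ 3) ^ L" using q y3 by (intro power_mono) auto
  also have "\<dots> = y ^ (3 * L)" by (simp only: power_mult)
  also have "\<dots> = y powr real (3 * L)" using y by (intro powr_realpow[symmetric]) simp
  also have "\<dots> \<le> s" unfolding s_def using y L(1) by (intro powr_mono) auto
  finally have "10 * real (q * (4 * q + 1) ^ (L - 1)) \<le> s * s"
    using s10 by (intro mult_mono) auto
  then have "10 * (q * (4 * q + 1) ^ (L - 1)) \<le> B"
    unfolding s by (metis of_nat_le_iff of_nat_mult of_nat_numeral)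
  moreover have "lam \<le> 12 * real L" using L(2,3) by linarith
  ultimately show ?thesis using L(3) by blast
qed

lemma eventually_log_small: "\<exists>X. \<forall>x\<ge>X. 2 * log 2 x \<le> (x :: real) / 32768"
proof -
  have "\<forall>\<^sub>F x :: real in at_top. 2 * log 2 x \<le> x / 32768" by real_asymp
  then show ?thesis by (simp add: eventually_at_top_linorder)
qed

theorem theorem3:
  assumes "undirected_k_pairs_conjecture"
  shows "\<exists>c>0. \<exists>n0. \<forall>n\<ge>n0. \<forall>M B w out. \<forall>R :: algorithm measure.
    n \<ge> 1 \<longrightarrow> w \<ge> 1 \<longrightarrow> B \<ge> 1 \<longrightarrow> B dvd n \<longrightarrow> B \<le> M \<longrightarrow>
    randomized_transpose_algorithm n M B w out (1/3) R \<longrightarrow>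
    (\<exists>A\<in>word_matrices n w.
      expected_ios n M B R A \<ge>
        ennreal (c * min (real n ^ 2 * log (2 * real M / real B) (real B) / real B)
                         (real n ^ 2 * real w / log 2 (real n ^ 2 * real w))))"
proof -
  \<comment> \<open>This makes \<open>6 * c = 1 / 100000\<close>, as the counting of patterns
    requires, and \<open>13 * 6 * 12 * c < 1\<close> for the final contradiction.\<close>
  define c :: real where "c = 1 / 600000"
  obtain X where X: "\<And>x. x \<ge> X \<Longrightarrow> 2 * log 2 x \<le> x / 32768"
    using eventually_log_small by blast
  define n0 where "n0 = max 10 (nat \<lceil>X\<rceil>)"
  have "\<exists>A\<in>word_matrices n w. expected_ios n M B R A \<ge>
        ennreal (c * min (real n ^ 2 * log (2 * real M / real B) (real B) / real B)
                         (real n ^ 2 * real w / log 2 (real n ^ 2 * real w)))"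
    if n: "n \<ge> n0" and w: "w \<ge> 1" and B: "B \<ge> 1" "B dvd n" "B \<le> M"
      and R: "randomized_transpose_algorithm n M B w out (1/3) R" for n M B w out R
  proof (rule ccontr)
    define lam where "lam = log (2 * real M / real B) (real B)"
    define m where "m = n * n * w"
    define Z where "Z = c * min (real n ^ 2 * lam / real B) (real m / log 2 m)"
    \<comment> \<open>Stopping after six times the supposed expectation fails with probability at
      most \<open>1 / 6\<close>; with the error \<open>1 / 3\<close>, half of the probability
      remains.\<close>
    define T where "T = nat \<lfloor>6 * Z\<rfloor>"
    define K where "K = n * (n div B)"
    assume "\<not> ?thesis"
    then have less: "expected_ios n M B R A < ennreal Z" if "A \<in> word_matrices n w" for A
      using that by (simp add: Z_def lam_def m_def power2_eq_square not_le)
    have n10: "n \<ge> 10" using n by (simp add: n0_def)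
    have nm: "n * n \<le> m" using mult_le_mono2[OF w, of "n * n"] by (simp add: m_def)
    have "1 * n \<le> n * n" using n10 by (intro mult_le_mono1) simp
    then have m10: "n \<le> m" "m \<ge> 10" using nm n10 by linarith+
    have "real m \<ge> X" using n m10 unfolding n0_def by linarith
    then have log_small: "2 * log 2 m \<le> real m / 32768" by (rule X)
    have log_ge: "log 2 m \<ge> 1" using m10 by (simp add: le_log_iff)
    obtain a0 where "a0 \<in> words (n * n) w" using words_nonempty by blast
    \<comment> \<open>An expectation below \<open>ennreal Z\<close> exists only for positive
      \<open>Z\<close>, as \<open>ennreal\<close> maps nonpositive reals to
      \<open>0\<close>.\<close>
    from less[OF mat_of_word_matrices[OF this]] have Z: "Z > 0"
      by (metis ennreal_neg not_less_zero not_le_imp_less)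
    have T: "real T \<le> 6 * Z" "6 * Z \<le> real T + 1" using Z unfolding T_def by linarith+
    have Zle: "Z \<le> c * (real n ^ 2 * lam / real B)" "Z \<le> c * (real m / log 2 m)"
      unfolding Z_def c_def by (simp_all add: mult_left_mono)
    have "real T \<le> real m / 100000 / log 2 m" using T(1) Zle(2) by (simp add: c_def)
    then have Tlog: "real T * log 2 m \<le> real m / 100000" using log_ge by (simp add: le_divide_eq)
    have "real T \<le> real T * log 2 m" using log_ge by (simp add: mult_le_cancel_left1)
    then have "real T \<le> real m" using Tlog by linarith
    then have Tm: "T \<le> m" by simp
    have "K \<le> n * n" unfolding K_def by (intro mult_le_mono2) simp
    then have "K \<le> m" using nm by linarith
    from few_patterns[OF m10(2) this Tm Tlog log_small]
    have few: "real (2 * ((T + 1) * ((K + T + 1) * (K + 1)) ^ T)) \<le> 2 powr (real (n * n * w) / 16384)"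
      by (simp add: m_def)
    interpret prob_space R using R by (simp add: randomized_transpose_algorithm_def)
    let ?W = "words (n * n) w"
    define E where "E a = {alg \<in> space R. transposes n M B out alg (mat_of n a)}
      - {alg \<in> space R. enat T < num_ios M B alg (input_disk n B (mat_of n a))}" for a
    have E: "E a \<in> events \<and> prob (E a) \<ge> 1 / 2" if a: "a \<in> ?W" for a
    proof -
      let ?A = "mat_of n a"
      let ?good = "{alg \<in> space R. transposes n M B out alg ?A}"
      let ?bad = "{alg \<in> space R. \<not> transposes n M B out alg ?A}"
      let ?slow = "{alg \<in> space R. enat T < num_ios M B alg (input_disk n B ?A)}"
      have A: "?A \<in> word_matrices n w" using a by (rule mat_of_word_matrices)
      have good: "?good \<in> events" and bad: "prob ?bad \<le> 1 / 3"
        and meas: "(\<lambda>alg. num_ios M B alg (input_disk n B ?A)) \<in> R \<rightarrow>\<^sub>M count_space UNIV"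
        using R A by (auto simp: randomized_transpose_algorithm_def)
      note slow = prob_many_ios[OF prob_space_axioms meas less[OF A, unfolded expected_ios_def] T(2) less_imp_le[OF Z]]
      have "?bad = space R - ?good" by auto
      then have "prob ?good \<ge> 2 / 3" using prob_compl[OF good] bad by simp
      moreover have "prob ?good \<le> prob (E a) + prob ?slow"
      proof -
        have "prob ?good \<le> prob (E a \<union> ?slow)"
          using good slow(1) by (intro finite_measure_mono) (auto simp: E_def)
        also have "\<dots> \<le> prob (E a) + prob ?slow"
          using good slow(1) by (intro measure_Un_le) (auto simp: E_def)
        finally show ?thesis .
      qed
      ultimately have "prob (E a) \<ge> 1 / 2" using slow(2) by linarith
      then show ?thesis using good slow(1) by (simp add: E_def)
    qed
    from exists_point_in_half[OF finite_words, of "n * n" w E] E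
    obtain alg where alg: "alg \<in> space R" "card ?W \<le> 2 * card {a \<in> ?W. alg \<in> E a}" by blast
    have valid: "valid_algorithm M B w alg"
      using R alg(1) by (simp add: randomized_transpose_algorithm_def)
    have correct: "\<exists>t\<le>T. \<forall>k<K. snd (run M B alg (flat_disk B K a) t) (out + k)
        = map (\<lambda>l. a (transpose_index n (k * B + l))) [0..<B]" if "a \<in> {a \<in> ?W. alg \<in> E a}" for a
    proof -
      let ?D = "input_disk n B (mat_of n a)"
      from that have "transposes n M B out alg (mat_of n a)" "\<not> enat T < num_ios M B alg ?D"
        by (auto simp: E_def)
      then obtain t where t: "num_ios M B alg ?D = enat t" "t \<le> T"
        and stored: "stored_at n B (snd (run M B alg ?D t)) out (transpose_mat (mat_of n a))"
        by (auto simp: transposes_def)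
      show ?thesis
        using t(2) stored_transpose_mat_of[OF B(2,1) stored]
        unfolding input_disk_mat_of[OF B(2,1)] K_def by blast
    qed
    from distance_choice[OF B(1,3)] obtain L
      where L: "L = 1 \<or> 10 * (M div B * (4 * (M div B) + 1) ^ (L - 1)) \<le> B" "L \<ge> 1" "lam \<le> 12 * real L"
      unfolding lam_def by blast
    \<comment> \<open>The chain bounds \<open>L * n ^ 2\<close> by \<open>936 * c\<close> times
      itself, which is absurd.\<close>
    have "real L * real (n * n) \<le> 13 * (real T * real B)"
      using deterministic_io_bound[OF assms n10 w B valid, of "{a \<in> ?W. alg \<in> E a}" T out L]
        alg(2) correct few L(1) unfolding K_def by blast
    also have "real T * real B \<le> 6 * Z * real B" using T(1) by (intro mult_right_mono) auto
    also have "6 * Z * real B \<le> 6 * (c * (real n ^ 2 * lam / real B)) * real B"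
      using Zle(1) by (intro mult_right_mono mult_left_mono) auto
    also have "\<dots> = 6 * c * lam * real (n * n)"
      using B(1) by (simp add: power2_eq_square)
    also have "6 * c * lam * real (n * n) \<le> 6 * c * (12 * real L) * real (n * n)"
      using L(3) by (intro mult_right_mono mult_left_mono) (auto simp: c_def)
    finally have "real L * real (n * n) \<le> 13 * (6 * c * (12 * real L) * real (n * n))" by simp
    moreover have "real L * real (n * n) > 0" using L(2) n10 by simp
    ultimately show False by (simp add: c_def)
  qed
  then show ?thesis
    by (intro exI[of _ c] conjI exI[of _ n0] allI impI) (simp_all add: c_def)
qed

end
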